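(* (1) In every temporal doctrine $\langle i_X:\mathcal M X\to\mathcal P X\leftarrow\mathcal M'X:i'_X;\ X\in\mathcal C\rangle$ there are, for every $X\in\mathcal C$, isomorphisms natural in $P\in\mathcal P X$, $M\in\mathcal M X$, $N\in\mathcal M'X$: (a) $i'_X N\Rightarrow i_X M\cong i_X\Box_X(i'_X N\Rightarrow i_X M)$ and $i_X M\Rightarrow i'_X N\cong i'_X\Box'_X(i_X M\Rightarrow i'_X N)$; (b) $\Box'_X(P\Rightarrow i_X M)\cong\Box'_X(i_X\Diamond_X P\Rightarrow i_X M)$ and $\Box_X(P\Rightarrow i'_X N)\cong\Box_X(i'_X\Diamond'_X P\Rightarrow i'_X N)$. (2) Each of the pairs of laws (a), (b) can be used in the definition of temporal doctrine in place of the pair of mixed Frobenius laws (axiom (B3)): for data satisfying all the axioms of a temporal doctrine except possibly (B3), the validity of (B3), of (a) (for all $X$), and of (b) (for all $X$) are equivalent. (3) Furthermore, in every temporal doctrine there are natural isomorphisms $$\Box_X(i_X M\Rightarrow P)\cong\Box_X(i_X M\Rightarrow i_X\Box_X P),\qquad \Box'_X(i'_X N\Rightarrow P)\cong\Box'_X(i'_X N\Rightarrow i'_X\Box'_X P).$$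
   Context: A temporal doctrine $\langle i_X:\mathcal M X\to\mathcal P X\leftarrow\mathcal M'X:i'_X;\ X\in\mathcal C\rangle$ consists of a category $\mathcal C$, three $\mathcal C$-indexed categories $\mathcal M,\mathcal P,\mathcal M'$ (pseudofunctors $\mathcal C^{op}\to\mathbf{Cat}$), and two indexed functors $i:\mathcal M\to\mathcal P$, $i':\mathcal M'\to\mathcal P$. The substitution functors along $f:X\to Y$ are written $f\cdot(-):\mathcal M Y\to\mathcal M X$, $f'\cdot(-):\mathcal M'Y\to\mathcal M'X$, $f^*:\mathcal P Y\to\mathcal P X$; thus $i_X(f\cdot M)\cong f^*i_Y M$ and $i'_X(f'\cdot N)\cong f^*i'_Y N$, coherently. $\mathcal B X:=\mathcal M X\times_{\mathcal P X}\mathcal M'X$ denotes the indexed pullback of $i$ and $i'$ (equalities up to the coherent isomorphisms), with projections $j_X:\mathcal B X\to\mathcal M X$, $j'_X:\mathcal B X\to\mathcal M'X$, and $b_X:=i_Xj_X=i'_Xj'_X:\mathcal B X\to\mathcal P X$. The axioms are: (A1) $\mathcal C$ has a terminal object $1$. (A2) Each $\mathcal P X$ is cartesian closed, with terminal object $1_X$, products $P\times_X Q$ and exponentials $P\Rightarrow Q$. (A3) Each $f^*$ has left and right adjoints $\Sigma_f\dashv f^*\dashv\Pi_f$. (A4) $i_X$ and $i'_X$ have left and right adjoints: $\Diamond_X\dashv i_X\dashv\Box_X$, $\Diamond'_X\dashv i'_X\dashv\Box'_X$. (A5) (comprehension) The canonical functor $c_X:\mathcal C/X\to\mathcal P X$,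 sending $f:T\to X$ to $\Sigma_f1_T$, has a right adjoint $k_X:\mathcal P X\to\mathcal C/X$. (B1) $i_X$ and $i'_X$ are fully faithful. (B2) (Frobenius law) $\Sigma_fP\times_YQ\cong\Sigma_f(P\times_Xf^*Q)$ canonically, naturally in $P\in\mathcal P X$, $Q\in\mathcal P Y$, for every $f:X\to Y$. (B3) (mixed Frobenius laws) The units of $\Diamond_X\dashv i_X$ and $\Diamond'_X\dashv i'_X$ induce isomorphisms $\Diamond_X(P\times_Xi'_XN)\cong\Diamond_X(i_X\Diamond_XP\times_Xi'_XN)$ and $\Diamond'_X(P\times_Xi_XM)\cong\Diamond'_X(i'_X\Diamond'_XP\times_Xi_XM)$, natural in $P\in\mathcal P X$, $M\in\mathcal M X$, $N\in\mathcal M'X$. (B4) $j_1:\mathcal B1\to\mathcal M1$ and $j'_1:\mathcal B1\to\mathcal M'1$ are isomorphisms. (B5) Each $k_X$ is fully faithful. *)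

theory Defs
  imports Main
begin

section \<open>Categories, functors, natural isomorphisms\<close>

text \<open>
  Objects and arrows form sets inside arbitrary types; operations are only meaningful
  on these carriers. \<open>g \<cdot>\<^bsub>A\<^esub> f\<close> is "first \<open>f\<close>, then \<open>g\<close>".
\<close>

record ('o, 'a) category =
  Obj :: "'o set"
  Arr :: "'a set"
  Dom :: "'a \<Rightarrow> 'o"
  Cod :: "'a \<Rightarrow> 'o"
  Ide :: "'o \<Rightarrow> 'a"
  Comp :: "'a \<Rightarrow> 'a \<Rightarrow> 'a" (infixl "\<cdot>\<index>" 70)

definition Hom :: "('o, 'a) category \<Rightarrow> 'o \<Rightarrow> 'o \<Rightarrow> 'a set" where
  "Hom A x y = {f \<in> Arr A. Dom A f = x \<and> Cod A f = y}"

locale category =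
  fixes A :: "('o, 'a) category"
  assumes Dom_in: "f \<in> Arr A \<Longrightarrow> Dom A f \<in> Obj A"
    and Cod_in: "f \<in> Arr A \<Longrightarrow> Cod A f \<in> Obj A"
    and Ide_in: "x \<in> Obj A \<Longrightarrow> Ide A x \<in> Hom A x x"
    and Comp_in: "\<lbrakk>f \<in> Hom A x y; g \<in> Hom A y z\<rbrakk> \<Longrightarrow> g \<cdot>\<^bsub>A\<^esub> f \<in> Hom A x z"
    and Comp_Ide: "f \<in> Hom A x y \<Longrightarrow> f \<cdot>\<^bsub>A\<^esub> Ide A x = f"
    and Ide_Comp: "f \<in> Hom A x y \<Longrightarrow> Ide A y \<cdot>\<^bsub>A\<^esub> f = f"
    and Comp_assoc: "\<lbrakk>f \<in> Hom A w x; g \<in> Hom A x y; h \<in> Hom A y z\<rbrakk>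
      \<Longrightarrow> (h \<cdot>\<^bsub>A\<^esub> g) \<cdot>\<^bsub>A\<^esub> f = h \<cdot>\<^bsub>A\<^esub> (g \<cdot>\<^bsub>A\<^esub> f)"

definition is_iso :: "('o, 'a) category \<Rightarrow> 'a \<Rightarrow> bool" where
  "is_iso A f \<longleftrightarrow> f \<in> Arr A \<and>
     (\<exists>g \<in> Hom A (Cod A f) (Dom A f).
        g \<cdot>\<^bsub>A\<^esub> f = Ide A (Dom A f) \<and> f \<cdot>\<^bsub>A\<^esub> g = Ide A (Cod A f))"

definition terminal_object :: "('o, 'a) category \<Rightarrow> 'o \<Rightarrow> bool" where
  "terminal_object A t \<longleftrightarrow> t \<in> Obj A \<and> (\<forall>x \<in> Obj A. \<exists>!f. f \<in> Hom A x t)"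

definition opposite :: "('o, 'a) category \<Rightarrow> ('o, 'a) category" where
  "opposite A = \<lparr>Obj = Obj A, Arr = Arr A, Dom = Cod A, Cod = Dom A, Ide = Ide A,
     Comp = (\<lambda>g f. f \<cdot>\<^bsub>A\<^esub> g)\<rparr>"

definition product_category ::
    "('o1, 'a1) category \<Rightarrow> ('o2, 'a2) category \<Rightarrow> ('o1 \<times> 'o2, 'a1 \<times> 'a2) category"
    (infixr "\<times>\<^sub>C" 80) where
  "A \<times>\<^sub>C B = \<lparr>Obj = Obj A \<times> Obj B, Arr = Arr A \<times> Arr B,
     Dom = map_prod (Dom A) (Dom B), Cod = map_prod (Cod A) (Cod B),
     Ide = map_prod (Ide A) (Ide B),
     Comp = (\<lambda>(g, g') (f, f'). (g \<cdot>\<^bsub>A\<^esub> f, g' \<cdot>\<^bsub>B\<^esub> f'))\<rparr>"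

text \<open>An arrow of the slice over \<open>x\<close> from \<open>f\<close> to \<open>g\<close> is a triple \<open>(f, h, g)\<close> with
  \<open>g \<cdot> h = f\<close>, so that it determines its domain and codomain.\<close>

definition slice :: "('o, 'a) category \<Rightarrow> 'o \<Rightarrow> ('a, 'a \<times> 'a \<times> 'a) category" where
  "slice A x = \<lparr>Obj = {f \<in> Arr A. Cod A f = x},
     Arr = {(f, h, g). f \<in> Arr A \<and> Cod A f = x \<and> g \<in> Arr A \<and> Cod A g = x \<and>
              h \<in> Hom A (Dom A f) (Dom A g) \<and> g \<cdot>\<^bsub>A\<^esub> h = f},
     Dom = (\<lambda>(f, h, g). f), Cod = (\<lambda>(f, h, g). g),
     Ide = (\<lambda>f. (f, Ide A (Dom A f), f)),
     Comp = (\<lambda>(_, k, g') (f, h, _). (f, k \<cdot>\<^bsub>A\<^esub> h, g'))\<rparr>"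

record ('o1, 'a1, 'o2, 'a2) cfunctor =
  fobj :: "'o1 \<Rightarrow> 'o2"
  farr :: "'a1 \<Rightarrow> 'a2"

text \<open>A functor from \<open>A\<close> to \<open>B\<close> and the induced functor from \<open>opposite A\<close> to
  \<open>opposite B\<close> are given by the same \<open>cfunctor\<close>.\<close>

locale is_functor = source: category A + target: category B
  for A :: "('o1, 'a1) category" and B :: "('o2, 'a2) category" +
  fixes F :: "('o1, 'a1, 'o2, 'a2) cfunctor"
  assumes fobj_in: "x \<in> Obj A \<Longrightarrow> fobj F x \<in> Obj B"
    and farr_in: "f \<in> Hom A x y \<Longrightarrow> farr F f \<in> Hom B (fobj F x) (fobj F y)"
    and farr_Ide: "x \<in> Obj A \<Longrightarrow> farr F (Ide A x) = Ide B (fobj F x)"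
    and farr_Comp: "\<lbrakk>f \<in> Hom A x y; g \<in> Hom A y z\<rbrakk>
      \<Longrightarrow> farr F (g \<cdot>\<^bsub>A\<^esub> f) = farr F g \<cdot>\<^bsub>B\<^esub> farr F f"

definition id_functor :: "('o, 'a, 'o, 'a) cfunctor" where
  "id_functor = \<lparr>fobj = (\<lambda>x. x), farr = (\<lambda>f. f)\<rparr>"

definition comp_functor ::
    "('o2, 'a2, 'o3, 'a3) cfunctor \<Rightarrow> ('o1, 'a1, 'o2, 'a2) cfunctor
      \<Rightarrow> ('o1, 'a1, 'o3, 'a3) cfunctor" (infixr "\<circ>\<^sub>F" 75) where
  "G \<circ>\<^sub>F F = \<lparr>fobj = (\<lambda>x. fobj G (fobj F x)), farr = (\<lambda>f. farr G (farr F f))\<rparr>"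

definition product_functor ::
    "('o1, 'a1, 'o2, 'a2) cfunctor \<Rightarrow> ('o3, 'a3, 'o4, 'a4) cfunctor
      \<Rightarrow> ('o1 \<times> 'o3, 'a1 \<times> 'a3, 'o2 \<times> 'o4, 'a2 \<times> 'a4) cfunctor" (infixr "\<times>\<^sub>F" 80) where
  "F \<times>\<^sub>F G = \<lparr>fobj = map_prod (fobj F) (fobj G), farr = map_prod (farr F) (farr G)\<rparr>"

definition fully_faithful ::
    "('o1, 'a1) category \<Rightarrow> ('o2, 'a2) category \<Rightarrow> ('o1, 'a1, 'o2, 'a2) cfunctor \<Rightarrow> bool" where
  "fully_faithful A B F \<longleftrightarrow> is_functor A B F \<and>
     (\<forall>x \<in> Obj A. \<forall>y \<in> Obj A. bij_betw (farr F) (Hom A x y) (Hom B (fobj F x) (fobj F y)))"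

definition nat_trans ::
    "('o1, 'a1) category \<Rightarrow> ('o2, 'a2) category
      \<Rightarrow> ('o1, 'a1, 'o2, 'a2) cfunctor \<Rightarrow> ('o1, 'a1, 'o2, 'a2) cfunctor
      \<Rightarrow> ('o1 \<Rightarrow> 'a2) \<Rightarrow> bool" where
  "nat_trans A B F G \<alpha> \<longleftrightarrow> is_functor A B F \<and> is_functor A B G \<and>
     (\<forall>x \<in> Obj A. \<alpha> x \<in> Hom B (fobj F x) (fobj G x)) \<and>
     (\<forall>f \<in> Arr A. \<alpha> (Cod A f) \<cdot>\<^bsub>B\<^esub> farr F f = farr G f \<cdot>\<^bsub>B\<^esub> \<alpha> (Dom A f))"

definition nat_iso ::
    "('o1, 'a1) category \<Rightarrow> ('o2, 'a2) category
      \<Rightarrow> ('o1, 'a1, 'o2, 'a2) cfunctor \<Rightarrow> ('o1, 'a1, 'o2, 'a2) cfunctor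
      \<Rightarrow> ('o1 \<Rightarrow> 'a2) \<Rightarrow> bool" where
  "nat_iso A B F G \<alpha> \<longleftrightarrow> nat_trans A B F G \<alpha> \<and> (\<forall>x \<in> Obj A. is_iso B (\<alpha> x))"

definition naturally_isomorphic ::
    "('o1, 'a1) category \<Rightarrow> ('o2, 'a2) category
      \<Rightarrow> ('o1, 'a1, 'o2, 'a2) cfunctor \<Rightarrow> ('o1, 'a1, 'o2, 'a2) cfunctor \<Rightarrow> bool" where
  "naturally_isomorphic A B F G \<longleftrightarrow> (\<exists>\<alpha>. nat_iso A B F G \<alpha>)"

definition equivalence ::
    "('o1, 'a1) category \<Rightarrow> ('o2, 'a2) category \<Rightarrow> ('o1, 'a1, 'o2, 'a2) cfunctor \<Rightarrow> bool" where
  "equivalence A B F \<longleftrightarrow> is_functor A B F \<and>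
     (\<exists>G. is_functor B A G \<and>
        naturally_isomorphic A A id_functor (G \<circ>\<^sub>F F) \<and>
        naturally_isomorphic B B (F \<circ>\<^sub>F G) id_functor)"

text \<open>\<open>F\<close> is left adjoint to \<open>G\<close>, with unit \<open>\<eta>\<close> and counit \<open>\<epsilon>\<close>.\<close>

definition adjunction ::
    "('o1, 'a1) category \<Rightarrow> ('o2, 'a2) category
      \<Rightarrow> ('o1, 'a1, 'o2, 'a2) cfunctor \<Rightarrow> ('o2, 'a2, 'o1, 'a1) cfunctor
      \<Rightarrow> ('o1 \<Rightarrow> 'a1) \<Rightarrow> ('o2 \<Rightarrow> 'a2) \<Rightarrow> bool" where
  "adjunction A B F G \<eta> \<epsilon> \<longleftrightarrow> is_functor A B F \<and> is_functor B A G \<and>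
     nat_trans A A id_functor (G \<circ>\<^sub>F F) \<eta> \<and>
     nat_trans B B (F \<circ>\<^sub>F G) id_functor \<epsilon> \<and>
     (\<forall>x \<in> Obj A. \<epsilon> (fobj F x) \<cdot>\<^bsub>B\<^esub> farr F (\<eta> x) = Ide B (fobj F x)) \<and>
     (\<forall>y \<in> Obj B. farr G (\<epsilon> y) \<cdot>\<^bsub>A\<^esub> \<eta> (fobj G y) = Ide A (fobj G y))"

definition adjoint ::
    "('o1, 'a1) category \<Rightarrow> ('o2, 'a2) category
      \<Rightarrow> ('o1, 'a1, 'o2, 'a2) cfunctor \<Rightarrow> ('o2, 'a2, 'o1, 'a1) cfunctor \<Rightarrow> bool" where
  "adjoint A B F G \<longleftrightarrow> (\<exists>\<eta> \<epsilon>. adjunction A B F G \<eta> \<epsilon>)"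

definition adjoint_with_unit ::
    "('o1, 'a1) category \<Rightarrow> ('o2, 'a2) category
      \<Rightarrow> ('o1, 'a1, 'o2, 'a2) cfunctor \<Rightarrow> ('o2, 'a2, 'o1, 'a1) cfunctor
      \<Rightarrow> ('o1 \<Rightarrow> 'a1) \<Rightarrow> bool" where
  "adjoint_with_unit A B F G \<eta> \<longleftrightarrow> (\<exists>\<epsilon>. adjunction A B F G \<eta> \<epsilon>)"

section \<open>Cartesian closed structure\<close>

text \<open>\<open>Exp K P Q\<close> is the exponential \<open>P \<Rightarrow> Q\<close>, with evaluation
  \<open>Eval K P Q : (P \<Rightarrow> Q) \<times> P \<rightarrow> Q\<close>.\<close>

record ('o, 'a) ccc =
  One :: 'o
  Prod :: "'o \<Rightarrow> 'o \<Rightarrow> 'o"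
  Fst :: "'o \<Rightarrow> 'o \<Rightarrow> 'a"
  Snd :: "'o \<Rightarrow> 'o \<Rightarrow> 'a"
  Exp :: "'o \<Rightarrow> 'o \<Rightarrow> 'o"
  Eval :: "'o \<Rightarrow> 'o \<Rightarrow> 'a"

definition bang :: "('o, 'a) category \<Rightarrow> ('o, 'a) ccc \<Rightarrow> 'o \<Rightarrow> 'a" where
  "bang A K x = (THE t. t \<in> Hom A x (One K))"

definition tuple :: "('o, 'a) category \<Rightarrow> ('o, 'a) ccc \<Rightarrow> 'a \<Rightarrow> 'a \<Rightarrow> 'a" where
  "tuple A K f g = (THE h. h \<in> Hom A (Dom A f) (Prod K (Cod A f) (Cod A g)) \<and>
     Fst K (Cod A f) (Cod A g) \<cdot>\<^bsub>A\<^esub> h = f \<and> Snd K (Cod A f) (Cod A g) \<cdot>\<^bsub>A\<^esub> h = g)"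

definition Prod_functor ::
    "('o, 'a) category \<Rightarrow> ('o, 'a) ccc \<Rightarrow> ('o \<times> 'o, 'a \<times> 'a, 'o, 'a) cfunctor" where
  "Prod_functor A K = \<lparr>fobj = (\<lambda>(P, Q). Prod K P Q),
     farr = (\<lambda>(f, g). tuple A K (f \<cdot>\<^bsub>A\<^esub> Fst K (Dom A f) (Dom A g))
                               (g \<cdot>\<^bsub>A\<^esub> Snd K (Dom A f) (Dom A g)))\<rparr>"

definition prod_arr :: "('o, 'a) category \<Rightarrow> ('o, 'a) ccc \<Rightarrow> 'a \<Rightarrow> 'a \<Rightarrow> 'a" where
  "prod_arr A K f g = farr (Prod_functor A K) (f, g)"

text \<open>\<open>curry A K R P Q f : R \<rightarrow> (P \<Rightarrow> Q)\<close> is the transpose of \<open>f : R \<times> P \<rightarrow> Q\<close>.\<close>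

definition curry ::
    "('o, 'a) category \<Rightarrow> ('o, 'a) ccc \<Rightarrow> 'o \<Rightarrow> 'o \<Rightarrow> 'o \<Rightarrow> 'a \<Rightarrow> 'a" where
  "curry A K R P Q f = (THE h. h \<in> Hom A R (Exp K P Q) \<and>
     Eval K P Q \<cdot>\<^bsub>A\<^esub> prod_arr A K h (Ide A P) = f)"

text \<open>The exponential as a functor from \<open>opposite A \<times>\<^sub>C A\<close> to \<open>A\<close>: a pair of arrows
  \<open>u : P' \<rightarrow> P\<close> and \<open>v : Q \<rightarrow> Q'\<close> of \<open>A\<close> is sent to \<open>(P \<Rightarrow> Q) \<rightarrow> (P' \<Rightarrow> Q')\<close>.\<close>

definition Exp_functor ::
    "('o, 'a) category \<Rightarrow> ('o, 'a) ccc \<Rightarrow> ('o \<times> 'o, 'a \<times> 'a, 'o, 'a) cfunctor" where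
  "Exp_functor A K = \<lparr>fobj = (\<lambda>(P, Q). Exp K P Q),
     farr = (\<lambda>(u, v).
       let E = Exp K (Cod A u) (Dom A v) in
       curry A K E (Dom A u) (Cod A v)
         (v \<cdot>\<^bsub>A\<^esub> Eval K (Cod A u) (Dom A v) \<cdot>\<^bsub>A\<^esub> prod_arr A K (Ide A E) u))\<rparr>"

locale cartesian_closed = category A
  for A :: "('o, 'a) category" +
  fixes K :: "('o, 'a) ccc"
  assumes One_terminal: "terminal_object A (One K)"
    and Prod_in: "\<lbrakk>P \<in> Obj A; Q \<in> Obj A\<rbrakk> \<Longrightarrow> Prod K P Q \<in> Obj A"
    and Fst_in: "\<lbrakk>P \<in> Obj A; Q \<in> Obj A\<rbrakk> \<Longrightarrow> Fst K P Q \<in> Hom A (Prod K P Q) P"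
    and Snd_in: "\<lbrakk>P \<in> Obj A; Q \<in> Obj A\<rbrakk> \<Longrightarrow> Snd K P Q \<in> Hom A (Prod K P Q) Q"
    and Prod_universal: "\<lbrakk>f \<in> Hom A R P; g \<in> Hom A R Q\<rbrakk>
      \<Longrightarrow> \<exists>!h. h \<in> Hom A R (Prod K P Q) \<and> Fst K P Q \<cdot>\<^bsub>A\<^esub> h = f \<and> Snd K P Q \<cdot>\<^bsub>A\<^esub> h = g"
    and Exp_in: "\<lbrakk>P \<in> Obj A; Q \<in> Obj A\<rbrakk> \<Longrightarrow> Exp K P Q \<in> Obj A"
    and Eval_in: "\<lbrakk>P \<in> Obj A; Q \<in> Obj A\<rbrakk> \<Longrightarrow> Eval K P Q \<in> Hom A (Prod K (Exp K P Q) P) Q"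
    and Exp_universal: "\<lbrakk>R \<in> Obj A; P \<in> Obj A; Q \<in> Obj A; f \<in> Hom A (Prod K R P) Q\<rbrakk>
      \<Longrightarrow> \<exists>!h. h \<in> Hom A R (Exp K P Q) \<and> Eval K P Q \<cdot>\<^bsub>A\<^esub> prod_arr A K h (Ide A P) = f"

section \<open>Indexed categories and indexed functors\<close>

text \<open>
  Pseudofunctors on the opposite of \<open>C\<close>: \<open>Sub E f\<close> is substitution along \<open>f : X \<rightarrow> Y\<close>, from
  the fibre over \<open>Y\<close> to the fibre over \<open>X\<close>; the structural isomorphisms are
  \<open>SubComp E f g x : f\<^sup>* (g\<^sup>* x) \<rightarrow> (g \<cdot> f)\<^sup>* x\<close> and \<open>SubIde E X x : x \<rightarrow> (id X)\<^sup>* x\<close>.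
\<close>

record ('c, 'f, 'o, 'a) indexed_category =
  Fib :: "'c \<Rightarrow> ('o, 'a) category"
  Sub :: "'f \<Rightarrow> ('o, 'a, 'o, 'a) cfunctor"
  SubComp :: "'f \<Rightarrow> 'f \<Rightarrow> 'o \<Rightarrow> 'a"
  SubIde :: "'c \<Rightarrow> 'o \<Rightarrow> 'a"

locale indexed_category = base: category C
  for C :: "('c, 'f) category" +
  fixes E :: "('c, 'f, 'o, 'a) indexed_category"
  assumes Fib_category: "X \<in> Obj C \<Longrightarrow> category (Fib E X)"
    and Sub_functor: "f \<in> Hom C X Y \<Longrightarrow> is_functor (Fib E Y) (Fib E X) (Sub E f)"
    and SubComp_iso: "\<lbrakk>f \<in> Hom C X Y; g \<in> Hom C Y Z\<rbrakk>
      \<Longrightarrow> nat_iso (Fib E Z) (Fib E X) (Sub E f \<circ>\<^sub>F Sub E g) (Sub E (g \<cdot>\<^bsub>C\<^esub> f)) (SubComp E f g)"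
    and SubIde_iso: "X \<in> Obj C
      \<Longrightarrow> nat_iso (Fib E X) (Fib E X) id_functor (Sub E (Ide C X)) (SubIde E X)"
    and Sub_assoc: "\<lbrakk>f \<in> Hom C W X; g \<in> Hom C X Y; h \<in> Hom C Y Z; x \<in> Obj (Fib E Z)\<rbrakk>
      \<Longrightarrow> SubComp E f (h \<cdot>\<^bsub>C\<^esub> g) x \<cdot>\<^bsub>Fib E W\<^esub> farr (Sub E f) (SubComp E g h x)
        = SubComp E (g \<cdot>\<^bsub>C\<^esub> f) h x \<cdot>\<^bsub>Fib E W\<^esub> SubComp E f g (fobj (Sub E h) x)"
    and Sub_Ide_right: "\<lbrakk>f \<in> Hom C X Y; x \<in> Obj (Fib E Y)\<rbrakk>
      \<Longrightarrow> SubComp E f (Ide C Y) x \<cdot>\<^bsub>Fib E X\<^esub> farr (Sub E f) (SubIde E Y x)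
        = Ide (Fib E X) (fobj (Sub E f) x)"
    and Sub_Ide_left: "\<lbrakk>f \<in> Hom C X Y; x \<in> Obj (Fib E Y)\<rbrakk>
      \<Longrightarrow> SubComp E (Ide C X) f x \<cdot>\<^bsub>Fib E X\<^esub> SubIde E X (fobj (Sub E f) x)
        = Ide (Fib E X) (fobj (Sub E f) x)"

text \<open>Pseudonatural transformations, with structural isomorphisms
  \<open>SubCompat T f x : T\<^bsub>X\<^esub> (f\<^sup>* x) \<rightarrow> f\<^sup>* (T\<^bsub>Y\<^esub> x)\<close>.\<close>

record ('c, 'f, 'o1, 'a1, 'o2, 'a2) indexed_functor =
  FunAt :: "'c \<Rightarrow> ('o1, 'a1, 'o2, 'a2) cfunctor"
  SubCompat :: "'f \<Rightarrow> 'o1 \<Rightarrow> 'a2"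

locale indexed_functor = source: indexed_category C E + target: indexed_category C E'
  for C :: "('c, 'f) category"
    and E :: "('c, 'f, 'o1, 'a1) indexed_category"
    and E' :: "('c, 'f, 'o2, 'a2) indexed_category" +
  fixes T :: "('c, 'f, 'o1, 'a1, 'o2, 'a2) indexed_functor"
  assumes FunAt_functor: "X \<in> Obj C \<Longrightarrow> is_functor (Fib E X) (Fib E' X) (FunAt T X)"
    and SubCompat_iso: "f \<in> Hom C X Y
      \<Longrightarrow> nat_iso (Fib E Y) (Fib E' X) (FunAt T X \<circ>\<^sub>F Sub E f) (Sub E' f \<circ>\<^sub>F FunAt T Y)
            (SubCompat T f)"
    and SubCompat_Comp: "\<lbrakk>f \<in> Hom C X Y; g \<in> Hom C Y Z; x \<in> Obj (Fib E Z)\<rbrakk>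
      \<Longrightarrow> SubCompat T (g \<cdot>\<^bsub>C\<^esub> f) x \<cdot>\<^bsub>Fib E' X\<^esub> farr (FunAt T X) (SubComp E f g x)
        = SubComp E' f g (fobj (FunAt T Z) x) \<cdot>\<^bsub>Fib E' X\<^esub>
          farr (Sub E' f) (SubCompat T g x) \<cdot>\<^bsub>Fib E' X\<^esub> SubCompat T f (fobj (Sub E g) x)"
    and SubCompat_Ide: "\<lbrakk>X \<in> Obj C; x \<in> Obj (Fib E X)\<rbrakk>
      \<Longrightarrow> SubCompat T (Ide C X) x \<cdot>\<^bsub>Fib E' X\<^esub> farr (FunAt T X) (SubIde E X x)
        = SubIde E' X (fobj (FunAt T X) x)"

text \<open>
  The fibres of the pullback of two indexed functors, with equalities taken up to specified
  isomorphism: objects are triples \<open>(m, n, \<phi>)\<close> with \<open>\<phi> : F m \<rightarrow> G n\<close> invertible.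
  (The strict pullback of the fibres would not be closed under substitution, since
  \<open>F\<close> and \<open>G\<close> commute with it only up to isomorphism.)
\<close>

definition pseudo_pullback ::
    "('o1, 'a1) category \<Rightarrow> ('o2, 'a2) category \<Rightarrow> ('o3, 'a3) category
      \<Rightarrow> ('o1, 'a1, 'o3, 'a3) cfunctor \<Rightarrow> ('o2, 'a2, 'o3, 'a3) cfunctor
      \<Rightarrow> ('o1 \<times> 'o2 \<times> 'a3, ('o1 \<times> 'o2 \<times> 'a3) \<times> ('a1 \<times> 'a2) \<times> ('o1 \<times> 'o2 \<times> 'a3)) category"
  where
  "pseudo_pullback A B P F G = (
     let Ob = {(m, n, \<phi>). m \<in> Obj A \<and> n \<in> Obj B \<and>
                 \<phi> \<in> Hom P (fobj F m) (fobj G n) \<and> is_iso P \<phi>} in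
     \<lparr>Obj = Ob,
      Arr = {((m, n, \<phi>), (u, v), (m', n', \<phi>')).
               (m, n, \<phi>) \<in> Ob \<and> (m', n', \<phi>') \<in> Ob \<and> u \<in> Hom A m m' \<and> v \<in> Hom B n n' \<and>
               farr G v \<cdot>\<^bsub>P\<^esub> \<phi> = \<phi>' \<cdot>\<^bsub>P\<^esub> farr F u},
      Dom = (\<lambda>(s, w, t). s), Cod = (\<lambda>(s, w, t). t),
      Ide = (\<lambda>(m, n, \<phi>). ((m, n, \<phi>), (Ide A m, Ide B n), (m, n, \<phi>))),
      Comp = (\<lambda>(_, (u', v'), t) (s, (u, v), _). (s, (u' \<cdot>\<^bsub>A\<^esub> u, v' \<cdot>\<^bsub>B\<^esub> v), t))\<rparr>)"

definition pb_fst ::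
    "('o1 \<times> 'o2 \<times> 'a3, ('o1 \<times> 'o2 \<times> 'a3) \<times> ('a1 \<times> 'a2) \<times> ('o1 \<times> 'o2 \<times> 'a3), 'o1, 'a1) cfunctor"
  where "pb_fst = \<lparr>fobj = (\<lambda>(m, n, \<phi>). m), farr = (\<lambda>(s, (u, v), t). u)\<rparr>"

definition pb_snd ::
    "('o1 \<times> 'o2 \<times> 'a3, ('o1 \<times> 'o2 \<times> 'a3) \<times> ('a1 \<times> 'a2) \<times> ('o1 \<times> 'o2 \<times> 'a3), 'o2, 'a2) cfunctor"
  where "pb_snd = \<lparr>fobj = (\<lambda>(m, n, \<phi>). n), farr = (\<lambda>(s, (u, v), t). v)\<rparr>"

section \<open>Temporal doctrines\<close>

text \<open>
  All structure whose existence is required is carried as chosen data. Units and counits are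
  included only where some axiom or construction refers to them; the others are quantified
  existentially in the axioms. Primed names belong to the second indexed category:
  \<open>Incl\<close>, \<open>Dia\<close>, \<open>Box\<close> are \<open>i\<close>, \<open>\<diamond>\<close>, \<open>\<box>\<close> and \<open>Incl'\<close>, \<open>Dia'\<close>, \<open>Box'\<close> are \<open>i'\<close>, \<open>\<diamond>'\<close>, \<open>\<box>'\<close>.
\<close>

record ('c, 'f, 'm, 'ma, 'p, 'pa, 'n, 'na) doctrine =
  Base :: "('c, 'f) category"
  Final :: 'c
  IndM :: "('c, 'f, 'm, 'ma) indexed_category"
  IndP :: "('c, 'f, 'p, 'pa) indexed_category"
  IndM' :: "('c, 'f, 'n, 'na) indexed_category"
  Incl :: "('c, 'f, 'm, 'ma, 'p, 'pa) indexed_functor"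
  Incl' :: "('c, 'f, 'n, 'na, 'p, 'pa) indexed_functor"
  Closed :: "'c \<Rightarrow> ('p, 'pa) ccc"
  Sigma :: "'f \<Rightarrow> ('p, 'pa, 'p, 'pa) cfunctor"
  SigmaUnit :: "'f \<Rightarrow> 'p \<Rightarrow> 'pa"
  SigmaCounit :: "'f \<Rightarrow> 'p \<Rightarrow> 'pa"
  Pi :: "'f \<Rightarrow> ('p, 'pa, 'p, 'pa) cfunctor"
  Dia :: "'c \<Rightarrow> ('p, 'pa, 'm, 'ma) cfunctor"
  DiaUnit :: "'c \<Rightarrow> 'p \<Rightarrow> 'pa"
  Box :: "'c \<Rightarrow> ('p, 'pa, 'm, 'ma) cfunctor"
  Dia' :: "'c \<Rightarrow> ('p, 'pa, 'n, 'na) cfunctor"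
  DiaUnit' :: "'c \<Rightarrow> 'p \<Rightarrow> 'pa"
  Box' :: "'c \<Rightarrow> ('p, 'pa, 'n, 'na) cfunctor"
  Ext :: "'c \<Rightarrow> ('p, 'pa, 'f, 'f \<times> 'f \<times> 'f) cfunctor"

abbreviation "CatM D X \<equiv> Fib (IndM D) X"
abbreviation "CatP D X \<equiv> Fib (IndP D) X"
abbreviation "CatM' D X \<equiv> Fib (IndM' D) X"
abbreviation "inc D X \<equiv> FunAt (Incl D) X"
abbreviation "inc' D X \<equiv> FunAt (Incl' D) X"

text \<open>
  The canonical functor from the slice over \<open>X\<close> to the fibre of \<open>P\<close> over \<open>X\<close>, sending
  \<open>f : T \<rightarrow> X\<close> to \<open>\<Sigma>\<^sub>f 1\<^sub>T\<close>. For \<open>h : T \<rightarrow> S\<close> with \<open>g \<cdot> h = f\<close>, the arrow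
  \<open>\<Sigma>\<^sub>f 1\<^sub>T \<rightarrow> \<Sigma>\<^sub>g 1\<^sub>S\<close> is the transpose of
  \<open>1\<^sub>T \<rightarrow> h\<^sup>* 1\<^sub>S \<rightarrow> h\<^sup>* (g\<^sup>* (\<Sigma>\<^sub>g 1\<^sub>S)) \<rightarrow> f\<^sup>* (\<Sigma>\<^sub>g 1\<^sub>S)\<close>; the first map,
  inverse to the unique \<open>h\<^sup>* 1\<^sub>S \<rightarrow> 1\<^sub>T\<close>, is obtained as the transpose of the unique
  \<open>\<Sigma>\<^sub>h 1\<^sub>T \<rightarrow> 1\<^sub>S\<close>.
\<close>

definition comprehension_functor ::
    "('c, 'f, 'm, 'ma, 'p, 'pa, 'n, 'na) doctrine \<Rightarrow> 'c
      \<Rightarrow> ('f, 'f \<times> 'f \<times> 'f, 'p, 'pa) cfunctor" where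
  "comprehension_functor D X = \<lparr>
     fobj = (\<lambda>f. fobj (Sigma D f) (One (Closed D (Dom (Base D) f)))),
     farr = (\<lambda>(f, h, g).
       let T = Dom (Base D) f; S = Dom (Base D) g;
           oneT = One (Closed D T); oneS = One (Closed D S);
           y = fobj (Sigma D g) oneS;
           \<theta> = farr (Sub (IndP D) h) (bang (CatP D S) (Closed D S) (fobj (Sigma D h) oneT))
                 \<cdot>\<^bsub>CatP D T\<^esub> SigmaUnit D h oneT
       in SigmaCounit D f y \<cdot>\<^bsub>CatP D X\<^esub>
          farr (Sigma D f)
            (SubComp (IndP D) h g y \<cdot>\<^bsub>CatP D T\<^esub>
             farr (Sub (IndP D) h) (SigmaUnit D g oneS) \<cdot>\<^bsub>CatP D T\<^esub> \<theta>))\<rparr>"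

text \<open>The Frobenius law for \<open>f : X \<rightarrow> Y\<close>: the canonical map
  \<open>\<Sigma>\<^sub>f (P \<times> f\<^sup>* Q) \<rightarrow> \<Sigma>\<^sub>f P \<times> Q\<close>, with components \<open>\<Sigma>\<^sub>f fst\<close> and
  \<open>\<epsilon>\<^sub>Q \<cdot> \<Sigma>\<^sub>f snd\<close>, is invertible.\<close>

definition frobenius_law ::
    "('c, 'f, 'm, 'ma, 'p, 'pa, 'n, 'na) doctrine \<Rightarrow> 'f \<Rightarrow> 'c \<Rightarrow> 'c \<Rightarrow> bool" where
  "frobenius_law D f X Y \<longleftrightarrow>
     nat_iso (CatP D X \<times>\<^sub>C CatP D Y) (CatP D Y)
       (Sigma D f \<circ>\<^sub>F Prod_functor (CatP D X) (Closed D X) \<circ>\<^sub>F (id_functor \<times>\<^sub>F Sub (IndP D) f))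
       (Prod_functor (CatP D Y) (Closed D Y) \<circ>\<^sub>F (Sigma D f \<times>\<^sub>F id_functor))
       (\<lambda>(P, Q). tuple (CatP D Y) (Closed D Y)
          (farr (Sigma D f) (Fst (Closed D X) P (fobj (Sub (IndP D) f) Q)))
          (SigmaCounit D f Q \<cdot>\<^bsub>CatP D Y\<^esub>
             farr (Sigma D f) (Snd (Closed D X) P (fobj (Sub (IndP D) f) Q))))"

text \<open>All axioms of a temporal doctrine except the mixed Frobenius laws.\<close>

locale predoctrine =
  fixes D :: "('c, 'f, 'm, 'ma, 'p, 'pa, 'n, 'na) doctrine"
  assumes Incl_indexed: "indexed_functor (Base D) (IndM D) (IndP D) (Incl D)"
    and Incl'_indexed: "indexed_functor (Base D) (IndM' D) (IndP D) (Incl' D)"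
    and A1: "terminal_object (Base D) (Final D)"
    and A2: "X \<in> Obj (Base D) \<Longrightarrow> cartesian_closed (CatP D X) (Closed D X)"
    and A3_Sigma: "f \<in> Hom (Base D) X Y \<Longrightarrow>
      adjunction (CatP D X) (CatP D Y) (Sigma D f) (Sub (IndP D) f)
        (SigmaUnit D f) (SigmaCounit D f)"
    and A3_Pi: "f \<in> Hom (Base D) X Y \<Longrightarrow>
      adjoint (CatP D Y) (CatP D X) (Sub (IndP D) f) (Pi D f)"
    and A4_Dia: "X \<in> Obj (Base D) \<Longrightarrow>
      adjoint_with_unit (CatP D X) (CatM D X) (Dia D X) (inc D X) (DiaUnit D X)"
    and A4_Box: "X \<in> Obj (Base D) \<Longrightarrow> adjoint (CatM D X) (CatP D X) (inc D X) (Box D X)"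
    and A4_Dia': "X \<in> Obj (Base D) \<Longrightarrow>
      adjoint_with_unit (CatP D X) (CatM' D X) (Dia' D X) (inc' D X) (DiaUnit' D X)"
    and A4_Box': "X \<in> Obj (Base D) \<Longrightarrow> adjoint (CatM' D X) (CatP D X) (inc' D X) (Box' D X)"
    and A5: "X \<in> Obj (Base D) \<Longrightarrow>
      adjoint (slice (Base D) X) (CatP D X) (comprehension_functor D X) (Ext D X)"
    and B1: "X \<in> Obj (Base D) \<Longrightarrow> fully_faithful (CatM D X) (CatP D X) (inc D X)"
    and B1': "X \<in> Obj (Base D) \<Longrightarrow> fully_faithful (CatM' D X) (CatP D X) (inc' D X)"
    and B2: "f \<in> Hom (Base D) X Y \<Longrightarrow> frobenius_law D f X Y"
    and B4: "equivalence
      (pseudo_pullback (CatM D (Final D)) (CatM' D (Final D)) (CatP D (Final D))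
         (inc D (Final D)) (inc' D (Final D)))
      (CatM D (Final D)) pb_fst"
    and B4': "equivalence
      (pseudo_pullback (CatM D (Final D)) (CatM' D (Final D)) (CatP D (Final D))
         (inc D (Final D)) (inc' D (Final D)))
      (CatM' D (Final D)) pb_snd"
    and B5: "X \<in> Obj (Base D) \<Longrightarrow> fully_faithful (CatP D X) (slice (Base D) X) (Ext D X)"

text \<open>
  The laws at one object, for one of the two members of each pair; the other member arises by
  exchanging the roles of the two indexed categories. Here \<open>P\<close> is a cartesian closed category
  with structure \<open>K\<close>, and \<open>i : M \<rightarrow> P\<close>, \<open>j : N \<rightarrow> P\<close>.
\<close>

definition mixed_frobenius_at ::
    "('p, 'pa) category \<Rightarrow> ('p, 'pa) ccc \<Rightarrow> ('m, 'ma) category \<Rightarrow> ('n, 'na) category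
      \<Rightarrow> ('m, 'ma, 'p, 'pa) cfunctor \<Rightarrow> ('n, 'na, 'p, 'pa) cfunctor
      \<Rightarrow> ('p, 'pa, 'm, 'ma) cfunctor \<Rightarrow> ('p \<Rightarrow> 'pa) \<Rightarrow> bool" where
  "mixed_frobenius_at P K M N i j dia \<eta> \<longleftrightarrow>
     nat_iso (P \<times>\<^sub>C N) M
       (dia \<circ>\<^sub>F Prod_functor P K \<circ>\<^sub>F (id_functor \<times>\<^sub>F j))
       (dia \<circ>\<^sub>F Prod_functor P K \<circ>\<^sub>F ((i \<circ>\<^sub>F dia) \<times>\<^sub>F j))
       (\<lambda>(p, n). farr dia (prod_arr P K (\<eta> p) (Ide P (fobj j n))))"

definition law_a_at ::
    "('p, 'pa) category \<Rightarrow> ('p, 'pa) ccc \<Rightarrow> ('m, 'ma) category \<Rightarrow> ('n, 'na) category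
      \<Rightarrow> ('m, 'ma, 'p, 'pa) cfunctor \<Rightarrow> ('n, 'na, 'p, 'pa) cfunctor
      \<Rightarrow> ('p, 'pa, 'm, 'ma) cfunctor \<Rightarrow> bool" where
  "law_a_at P K M N i j box \<longleftrightarrow>
     naturally_isomorphic (opposite N \<times>\<^sub>C M) P
       (Exp_functor P K \<circ>\<^sub>F (j \<times>\<^sub>F i))
       (i \<circ>\<^sub>F box \<circ>\<^sub>F Exp_functor P K \<circ>\<^sub>F (j \<times>\<^sub>F i))"

definition law_b_at ::
    "('p, 'pa) category \<Rightarrow> ('p, 'pa) ccc \<Rightarrow> ('m, 'ma) category \<Rightarrow> ('n, 'na) category
      \<Rightarrow> ('m, 'ma, 'p, 'pa) cfunctor \<Rightarrow> ('p, 'pa, 'm, 'ma) cfunctor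
      \<Rightarrow> ('p, 'pa, 'n, 'na) cfunctor \<Rightarrow> bool" where
  "law_b_at P K M N i dia box' \<longleftrightarrow>
     naturally_isomorphic (opposite P \<times>\<^sub>C M) N
       (box' \<circ>\<^sub>F Exp_functor P K \<circ>\<^sub>F (id_functor \<times>\<^sub>F i))
       (box' \<circ>\<^sub>F Exp_functor P K \<circ>\<^sub>F ((i \<circ>\<^sub>F dia) \<times>\<^sub>F i))"

definition box_law_at ::
    "('p, 'pa) category \<Rightarrow> ('p, 'pa) ccc \<Rightarrow> ('m, 'ma) category
      \<Rightarrow> ('m, 'ma, 'p, 'pa) cfunctor \<Rightarrow> ('p, 'pa, 'm, 'ma) cfunctor \<Rightarrow> bool" where
  "box_law_at P K M i box \<longleftrightarrow>
     naturally_isomorphic (opposite M \<times>\<^sub>C P) M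
       (box \<circ>\<^sub>F Exp_functor P K \<circ>\<^sub>F (i \<times>\<^sub>F id_functor))
       (box \<circ>\<^sub>F Exp_functor P K \<circ>\<^sub>F (i \<times>\<^sub>F (i \<circ>\<^sub>F box)))"

definition mixed_frobenius_laws ::
    "('c, 'f, 'm, 'ma, 'p, 'pa, 'n, 'na) doctrine \<Rightarrow> 'c \<Rightarrow> bool" where
  "mixed_frobenius_laws D X \<longleftrightarrow>
     mixed_frobenius_at (CatP D X) (Closed D X) (CatM D X) (CatM' D X)
       (inc D X) (inc' D X) (Dia D X) (DiaUnit D X) \<and>
     mixed_frobenius_at (CatP D X) (Closed D X) (CatM' D X) (CatM D X)
       (inc' D X) (inc D X) (Dia' D X) (DiaUnit' D X)"

definition laws_a ::
    "('c, 'f, 'm, 'ma, 'p, 'pa, 'n, 'na) doctrine \<Rightarrow> 'c \<Rightarrow> bool" where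
  "laws_a D X \<longleftrightarrow>
     law_a_at (CatP D X) (Closed D X) (CatM D X) (CatM' D X) (inc D X) (inc' D X) (Box D X) \<and>
     law_a_at (CatP D X) (Closed D X) (CatM' D X) (CatM D X) (inc' D X) (inc D X) (Box' D X)"

definition laws_b ::
    "('c, 'f, 'm, 'ma, 'p, 'pa, 'n, 'na) doctrine \<Rightarrow> 'c \<Rightarrow> bool" where
  "laws_b D X \<longleftrightarrow>
     law_b_at (CatP D X) (Closed D X) (CatM D X) (CatM' D X) (inc D X) (Dia D X) (Box' D X) \<and>
     law_b_at (CatP D X) (Closed D X) (CatM' D X) (CatM D X) (inc' D X) (Dia' D X) (Box D X)"

definition box_laws ::
    "('c, 'f, 'm, 'ma, 'p, 'pa, 'n, 'na) doctrine \<Rightarrow> 'c \<Rightarrow> bool" where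
  "box_laws D X \<longleftrightarrow>
     box_law_at (CatP D X) (Closed D X) (CatM D X) (inc D X) (Box D X) \<and>
     box_law_at (CatP D X) (Closed D X) (CatM' D X) (inc' D X) (Box' D X)"

locale temporal_doctrine = predoctrine D
  for D :: "('c, 'f, 'm, 'ma, 'p, 'pa, 'n, 'na) doctrine" +
  assumes B3: "X \<in> Obj (Base D) \<Longrightarrow> mixed_frobenius_laws D X"

end

theory Submission
  imports Defs
begin

text \<open>
  Everything happens in one fibre. Call an arrow \<open>f : x \<rightarrow> y\<close> orthogonal to \<open>z\<close> if every arrow
  \<open>x \<rightarrow> z\<close> factors uniquely through \<open>f\<close>. Let \<open>\<eta>\<close> be the unit of the reflection \<open>\<diamond>\<close> onto the
  image of \<open>i\<close>. By Yoneda and adjunction, the mixed Frobenius map at \<open>(P, N)\<close> is invertible iff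
  \<open>\<eta>\<^sub>P \<times> i' N\<close> is orthogonal to all \<open>i M\<close>. Transposing along \<open>(-) \<times> i' N\<close>, this says that
  \<open>\<eta>\<^sub>P\<close> is orthogonal to \<open>i' N \<Rightarrow> i M\<close>; for all \<open>P\<close>, that \<open>i' N \<Rightarrow> i M\<close> lies in the essential
  image of \<open>i\<close>, which is (a). Transposing along \<open>P \<times> (-)\<close> instead, it says that
  \<open>\<box>' (\<eta>\<^sub>P \<Rightarrow> i M)\<close> is invertible, which gives (b); conversely, any isomorphism (b) natural in \<open>P\<close>
  makes this map invertible, since \<open>i \<diamond> \<eta>\<^sub>P\<close> is. Finally, (3) holds because the image of \<open>i\<close> is closed
  under products. Statements about \<open>\<box>\<close> are those about \<open>\<diamond>\<close> in the opposite categories.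
\<close>

section \<open>Categories and natural transformations\<close>

context category
begin

lemma Hom_iff: "f \<in> Hom A x y \<longleftrightarrow> f \<in> Arr A \<and> Dom A f = x \<and> Cod A f = y"
  by (simp add: Hom_def)

lemma Dom_Obj [simp]: "f \<in> Arr A \<Longrightarrow> Dom A f \<in> Obj A"
  and Cod_Obj [simp]: "f \<in> Arr A \<Longrightarrow> Cod A f \<in> Obj A"
  by (simp_all add: Dom_in Cod_in)

lemma Ide_arrow [simp]:
  assumes "x \<in> Obj A"
  shows "Ide A x \<in> Arr A" "Dom A (Ide A x) = x" "Cod A (Ide A x) = x"
  using Ide_in[OF assms] by (simp_all add: Hom_def)

lemma Comp_arrow [simp]:
  assumes "f \<in> Arr A" "g \<in> Arr A" "Cod A f = Dom A g"
  shows "g \<cdot>\<^bsub>A\<^esub> f \<in> Arr A" "Dom A (g \<cdot>\<^bsub>A\<^esub> f) = Dom A f" "Cod A (g \<cdot>\<^bsub>A\<^esub> f) = Cod A g"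
  using Comp_in[of f "Dom A f" "Cod A f" g "Cod A g"] assms by (simp_all add: Hom_def)

lemma Comp_Ide_right [simp]: "f \<in> Arr A \<Longrightarrow> Dom A f = x \<Longrightarrow> f \<cdot>\<^bsub>A\<^esub> Ide A x = f"
  by (rule Comp_Ide[of f x "Cod A f"]) (simp add: Hom_def)

lemma Comp_Ide_left [simp]: "f \<in> Arr A \<Longrightarrow> Cod A f = x \<Longrightarrow> Ide A x \<cdot>\<^bsub>A\<^esub> f = f"
  by (rule Ide_Comp[of f "Dom A f"]) (simp add: Hom_def)

lemma assoc [simp]:
  assumes "f \<in> Arr A" "g \<in> Arr A" "h \<in> Arr A" "Cod A f = Dom A g" "Cod A g = Dom A h"
  shows "(h \<cdot>\<^bsub>A\<^esub> g) \<cdot>\<^bsub>A\<^esub> f = h \<cdot>\<^bsub>A\<^esub> (g \<cdot>\<^bsub>A\<^esub> f)"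
  by (rule Comp_assoc[of f "Dom A f" "Cod A f" g "Cod A g" h "Cod A h"])
    (use assms in \<open>simp_all add: Hom_def\<close>)

lemma isoI:
  assumes "f \<in> Hom A x y" "g \<in> Hom A y x" "g \<cdot>\<^bsub>A\<^esub> f = Ide A x" "f \<cdot>\<^bsub>A\<^esub> g = Ide A y"
  shows "is_iso A f"
  using assms by (auto simp: is_iso_def Hom_def)

lemma isoE:
  assumes "is_iso A f"
  obtains g where "f \<in> Arr A" "g \<in> Arr A" "Dom A g = Cod A f" "Cod A g = Dom A f"
    "g \<cdot>\<^bsub>A\<^esub> f = Ide A (Dom A f)" "f \<cdot>\<^bsub>A\<^esub> g = Ide A (Cod A f)"
  using assms by (auto simp: is_iso_def Hom_def)

lemma iso_Ide: "x \<in> Obj A \<Longrightarrow> is_iso A (Ide A x)"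
  by (rule isoI[of _ x x "Ide A x"]) (simp_all add: Hom_iff)

lemma iso_inverse:
  assumes "is_iso A f" "f \<in> Hom A x y"
  obtains g where "g \<in> Hom A y x" "is_iso A g" "g \<cdot>\<^bsub>A\<^esub> f = Ide A x" "f \<cdot>\<^bsub>A\<^esub> g = Ide A y"
proof -
  obtain g where g: "g \<in> Hom A y x" "g \<cdot>\<^bsub>A\<^esub> f = Ide A x" "f \<cdot>\<^bsub>A\<^esub> g = Ide A y"
    using assms by (auto simp: is_iso_def Hom_def)
  then have "is_iso A g" using assms(2) by (intro isoI[of g y x f])
  with g that show thesis by blast
qed

lemma iso_Comp:
  assumes "is_iso A f" "is_iso A g" "Cod A f = Dom A g"
  shows "is_iso A (g \<cdot>\<^bsub>A\<^esub> f)"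
proof -
  obtain f' where f': "f \<in> Arr A" "f' \<in> Arr A" "Dom A f' = Cod A f" "Cod A f' = Dom A f"
    "f' \<cdot>\<^bsub>A\<^esub> f = Ide A (Dom A f)" "f \<cdot>\<^bsub>A\<^esub> f' = Ide A (Cod A f)"
    using assms(1) by (rule isoE)
  obtain g' where g': "g \<in> Arr A" "g' \<in> Arr A" "Dom A g' = Cod A g" "Cod A g' = Dom A g"
    "g' \<cdot>\<^bsub>A\<^esub> g = Ide A (Dom A g)" "g \<cdot>\<^bsub>A\<^esub> g' = Ide A (Cod A g)"
    using assms(2) by (rule isoE)
  have "g' \<cdot>\<^bsub>A\<^esub> (g \<cdot>\<^bsub>A\<^esub> f) = f" "f \<cdot>\<^bsub>A\<^esub> (f' \<cdot>\<^bsub>A\<^esub> g') = g'"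
    using assms(3) f' g' assoc[of f g g'] assoc[of g' f' f] by simp_all
  then show ?thesis
    using assms(3) f' g' by (intro isoI[of _ "Dom A f" "Cod A g" "f' \<cdot>\<^bsub>A\<^esub> g'"]) (simp_all add: Hom_iff)
qed

text \<open>Composing with the inverse of \<open>g\<close> recovers \<open>f\<close> as a composite
  of isomorphisms. This half of two-out-of-three lets the converse for law (b) strip off a component
  of the given isomorphism.\<close>

lemma iso_cancel_left:
  assumes "is_iso A (g \<cdot>\<^bsub>A\<^esub> f)" "is_iso A g" "f \<in> Arr A" "Cod A f = Dom A g"
  shows "is_iso A f"
proof -
  have g: "g \<in> Arr A" using assms(2) by (simp add: is_iso_def)
  then have "g \<in> Hom A (Dom A g) (Cod A g)" by (simp add: Hom_iff)
  with assms(2) obtain g' where g': "g' \<in> Hom A (Cod A g) (Dom A g)" "is_iso A g'"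
    "g' \<cdot>\<^bsub>A\<^esub> g = Ide A (Dom A g)"
    by (rule iso_inverse)
  have "is_iso A (g' \<cdot>\<^bsub>A\<^esub> (g \<cdot>\<^bsub>A\<^esub> f))"
    using assms g g' by (intro iso_Comp[of _ g']) (simp_all add: Hom_iff)
  moreover have "g' \<cdot>\<^bsub>A\<^esub> (g \<cdot>\<^bsub>A\<^esub> f) = f"
    using assms g g' assoc[of f g g'] by (simp add: Hom_iff)
  ultimately show ?thesis by simp
qed

end

section \<open>Opposite and product categories\<close>

lemma opposite_simps [simp]:
  "Obj (opposite A) = Obj A" "Arr (opposite A) = Arr A" "Dom (opposite A) = Cod A"
  "Cod (opposite A) = Dom A" "Ide (opposite A) = Ide A" "g \<cdot>\<^bsub>opposite A\<^esub> f = f \<cdot>\<^bsub>A\<^esub> g"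
  by (simp_all add: opposite_def)

lemma Hom_opposite [simp]: "Hom (opposite A) x y = Hom A y x"
  by (auto simp: Hom_def)

lemma is_iso_opposite [simp]: "is_iso (opposite A) f = is_iso A f"
  by (auto simp: is_iso_def)

lemma (in category) category_opposite: "category (opposite A)"
  by unfold_locales (auto simp: Hom_def)

lemma product_category_simps [simp]:
  "Obj (A \<times>\<^sub>C B) = Obj A \<times> Obj B" "Arr (A \<times>\<^sub>C B) = Arr A \<times> Arr B"
  "Dom (A \<times>\<^sub>C B) (f, f') = (Dom A f, Dom B f')" "Cod (A \<times>\<^sub>C B) (f, f') = (Cod A f, Cod B f')"
  "Ide (A \<times>\<^sub>C B) (x, y) = (Ide A x, Ide B y)"
  "(g, g') \<cdot>\<^bsub>A \<times>\<^sub>C B\<^esub> (f, f') = (g \<cdot>\<^bsub>A\<^esub> f, g' \<cdot>\<^bsub>B\<^esub> f')"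
  by (simp_all add: product_category_def)

lemma Hom_product [simp]: "Hom (A \<times>\<^sub>C B) (x, y) (x', y') = Hom A x x' \<times> Hom B y y'"
  by (auto simp: Hom_def)

lemma category_product:
  assumes "category A" "category B"
  shows "category (A \<times>\<^sub>C B)"
proof -
  interpret A: category A by fact
  interpret B: category B by fact
  show ?thesis
    by unfold_locales (auto simp: A.Hom_iff B.Hom_iff Hom_def)
qed

lemma is_iso_product:
  assumes "is_iso A f" "is_iso B g"
  shows "is_iso (A \<times>\<^sub>C B) (f, g)"
  using assms by (fastforce simp: is_iso_def)

section \<open>Functors, their composites and products\<close>

context is_functor
begin

lemma fobj_Obj [simp]: "x \<in> Obj A \<Longrightarrow> fobj F x \<in> Obj B"
  by (rule fobj_in)

lemma farr_arrow [simp]: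
  assumes "f \<in> Arr A"
  shows "farr F f \<in> Arr B" "Dom B (farr F f) = fobj F (Dom A f)"
    "Cod B (farr F f) = fobj F (Cod A f)"
  using farr_in[of f "Dom A f" "Cod A f"] assms by (simp_all add: Hom_def)

lemma farr_Ide' [simp]: "x \<in> Obj A \<Longrightarrow> farr F (Ide A x) = Ide B (fobj F x)"
  by (rule farr_Ide)

lemma farr_Comp' [simp]:
  assumes "f \<in> Arr A" "g \<in> Arr A" "Cod A f = Dom A g"
  shows "farr F (g \<cdot>\<^bsub>A\<^esub> f) = farr F g \<cdot>\<^bsub>B\<^esub> farr F f"
  using assms by (intro farr_Comp[of f "Dom A f" "Cod A f" g "Cod A g"]) (simp_all add: Hom_def)

lemma farr_iso:
  assumes "is_iso A f"
  shows "is_iso B (farr F f)"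
proof -
  obtain g where g: "f \<in> Arr A" "g \<in> Arr A" "Dom A g = Cod A f" "Cod A g = Dom A f"
    "g \<cdot>\<^bsub>A\<^esub> f = Ide A (Dom A f)" "f \<cdot>\<^bsub>A\<^esub> g = Ide A (Cod A f)"
    using assms by (rule source.isoE)
  then have "farr F g \<cdot>\<^bsub>B\<^esub> farr F f = Ide B (fobj F (Dom A f))"
    "farr F f \<cdot>\<^bsub>B\<^esub> farr F g = Ide B (fobj F (Cod A f))"
    using farr_Comp'[of f g] farr_Comp'[of g f] by simp_all
  with g show ?thesis
    by (intro target.isoI[of _ "fobj F (Dom A f)" "fobj F (Cod A f)" "farr F g"])
      (simp_all add: target.Hom_iff)
qed

lemma is_functor_opposite: "is_functor (opposite A) (opposite B) F"
  by (intro is_functor.intro source.category_opposite target.category_opposite)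
    (unfold_locales, auto simp: source.Hom_iff target.Hom_iff)

end

lemma is_functorI:
  assumes "category A" "category B"
    and "\<And>x. x \<in> Obj A \<Longrightarrow> fobj F x \<in> Obj B"
    and "\<And>f. f \<in> Arr A \<Longrightarrow> farr F f \<in> Hom B (fobj F (Dom A f)) (fobj F (Cod A f))"
    and "\<And>x. x \<in> Obj A \<Longrightarrow> farr F (Ide A x) = Ide B (fobj F x)"
    and "\<And>f g. \<lbrakk>f \<in> Arr A; g \<in> Arr A; Cod A f = Dom A g\<rbrakk>
      \<Longrightarrow> farr F (g \<cdot>\<^bsub>A\<^esub> f) = farr F g \<cdot>\<^bsub>B\<^esub> farr F f"
  shows "is_functor A B F"
  using assms by (intro is_functor.intro is_functor_axioms.intro) (auto simp: Hom_def)

lemma functor_simps [simp]: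
  "fobj id_functor x = x" "farr id_functor f = f"
  "fobj (G \<circ>\<^sub>F F) x = fobj G (fobj F x)" "farr (G \<circ>\<^sub>F F) f = farr G (farr F f)"
  "fobj (H \<times>\<^sub>F H') (y, y') = (fobj H y, fobj H' y')"
  "farr (H \<times>\<^sub>F H') (h, h') = (farr H h, farr H' h')"
  by (simp_all add: id_functor_def comp_functor_def product_functor_def)

lemma id_functor_comp [simp]: "id_functor \<circ>\<^sub>F F = F"
  by (simp add: id_functor_def comp_functor_def)

lemma comp_functor_assoc: "(H \<circ>\<^sub>F G) \<circ>\<^sub>F F = H \<circ>\<^sub>F (G \<circ>\<^sub>F F)"
  by (simp add: comp_functor_def)

lemma is_functor_comp:
  assumes "is_functor A B F" "is_functor B C G"
  shows "is_functor A C (G \<circ>\<^sub>F F)"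
proof -
  interpret F: is_functor A B F by fact
  interpret G: is_functor B C G by fact
  show ?thesis
    by (rule is_functorI[OF F.source.category_axioms G.target.category_axioms])
      (simp_all add: Hom_def)
qed

lemma is_functor_product:
  assumes "is_functor A B F" "is_functor A' B' F'"
  shows "is_functor (A \<times>\<^sub>C A') (B \<times>\<^sub>C B') (F \<times>\<^sub>F F')"
proof -
  interpret F: is_functor A B F by fact
  interpret F': is_functor A' B' F' by fact
  show ?thesis
    by (rule is_functorI[OF category_product category_product])
      (auto simp: F.source.category_axioms F.target.category_axioms
        F'.source.category_axioms F'.target.category_axioms Hom_def)
qed

section \<open>Natural transformations, whiskering and inversion\<close>

lemma nat_trans_opposite:
  assumes "nat_trans A B F G \<alpha>"
  shows "nat_trans (opposite A) (opposite B) G F \<alpha>"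
  using assms unfolding nat_trans_def by (auto intro: is_functor.is_functor_opposite)

lemma nat_trans_Ide:
  assumes "is_functor A B F"
  shows "nat_trans A B F F (\<lambda>x. Ide B (fobj F x))"
proof -
  interpret is_functor A B F by fact
  show ?thesis
    unfolding nat_trans_def using assms by (simp add: Hom_def)
qed

lemma nat_trans_whisker_left:
  assumes "nat_trans A B F G \<alpha>" "is_functor B C H"
  shows "nat_trans A C (H \<circ>\<^sub>F F) (H \<circ>\<^sub>F G) (\<lambda>x. farr H (\<alpha> x))"
proof -
  interpret F: is_functor A B F using assms(1) by (simp add: nat_trans_def)
  interpret G: is_functor A B G using assms(1) by (simp add: nat_trans_def)
  interpret H: is_functor B C H by fact
  have \<alpha>: "\<alpha> x \<in> Arr B" "Dom B (\<alpha> x) = fobj F x" "Cod B (\<alpha> x) = fobj G x" if "x \<in> Obj A" for x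
    using assms(1) that by (auto simp: nat_trans_def Hom_def)
  have "\<alpha> (Cod A f) \<cdot>\<^bsub>B\<^esub> farr F f = farr G f \<cdot>\<^bsub>B\<^esub> \<alpha> (Dom A f)" if "f \<in> Arr A" for f
    using assms(1) that by (simp add: nat_trans_def)
  then have "farr H (\<alpha> (Cod A f)) \<cdot>\<^bsub>C\<^esub> farr H (farr F f)
      = farr H (farr G f) \<cdot>\<^bsub>C\<^esub> farr H (\<alpha> (Dom A f))" if "f \<in> Arr A" for f
    using that \<alpha> H.farr_Comp' by (metis F.farr_arrow G.farr_arrow F.source.Cod_Obj F.source.Dom_Obj)
  with \<alpha> show ?thesis
    unfolding nat_trans_def
    by (auto simp: Hom_def intro!: is_functor_comp F.is_functor_axioms G.is_functor_axioms H.is_functor_axioms)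
qed

lemma nat_trans_whisker_right:
  assumes "nat_trans B C F G \<alpha>" "is_functor A B H"
  shows "nat_trans A C (F \<circ>\<^sub>F H) (G \<circ>\<^sub>F H) (\<lambda>x. \<alpha> (fobj H x))"
proof -
  interpret H: is_functor A B H by fact
  show ?thesis
    using assms unfolding nat_trans_def
    by (auto intro!: is_functor_comp)
      (metis H.farr_arrow)
qed

lemma nat_trans_product:
  assumes "nat_trans A B F G \<alpha>" "nat_trans A' B' F' G' \<alpha>'"
  shows "nat_trans (A \<times>\<^sub>C A') (B \<times>\<^sub>C B') (F \<times>\<^sub>F F') (G \<times>\<^sub>F G') (\<lambda>(x, x'). (\<alpha> x, \<alpha>' x'))"
  using assms unfolding nat_trans_def by (auto intro!: is_functor_product)

lemma naturally_isomorphicI: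
  "nat_trans A B F G \<alpha> \<Longrightarrow> (\<And>x. x \<in> Obj A \<Longrightarrow> is_iso B (\<alpha> x)) \<Longrightarrow> naturally_isomorphic A B F G"
  by (auto simp: naturally_isomorphic_def nat_iso_def)

text \<open>Inverses of the components are again natural. The canonical maps built below from units
  and counits often run from the right-hand side of a law to its left-hand side, and this turns them
  around.\<close>

lemma naturally_isomorphic_sym:
  assumes "naturally_isomorphic A B F G"
  shows "naturally_isomorphic A B G F"
proof -
  obtain \<alpha> where nt: "nat_trans A B F G \<alpha>" and iso: "\<And>x. x \<in> Obj A \<Longrightarrow> is_iso B (\<alpha> x)"
    using assms by (auto simp: naturally_isomorphic_def nat_iso_def)
  interpret F: is_functor A B F using nt by (simp add: nat_trans_def)
  interpret G: is_functor A B G using nt by (simp add: nat_trans_def)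
  have \<alpha>: "\<alpha> x \<in> Arr B" "Dom B (\<alpha> x) = fobj F x" "Cod B (\<alpha> x) = fobj G x" if "x \<in> Obj A" for x
    using nt that by (auto simp: nat_trans_def Hom_def)
  have "\<exists>g. g \<in> Hom B (fobj G x) (fobj F x) \<and> is_iso B g \<and>
      g \<cdot>\<^bsub>B\<^esub> \<alpha> x = Ide B (fobj F x) \<and> \<alpha> x \<cdot>\<^bsub>B\<^esub> g = Ide B (fobj G x)" if "x \<in> Obj A" for x
    by (rule F.target.iso_inverse[OF iso[OF that], of "fobj F x" "fobj G x"])
      (use \<alpha> that in \<open>auto simp: F.target.Hom_iff\<close>)
  then obtain \<beta> where \<beta>: "\<And>x. x \<in> Obj A \<Longrightarrow> \<beta> x \<in> Hom B (fobj G x) (fobj F x)"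
      "\<And>x. x \<in> Obj A \<Longrightarrow> is_iso B (\<beta> x)"
      "\<And>x. x \<in> Obj A \<Longrightarrow> \<beta> x \<cdot>\<^bsub>B\<^esub> \<alpha> x = Ide B (fobj F x)"
      "\<And>x. x \<in> Obj A \<Longrightarrow> \<alpha> x \<cdot>\<^bsub>B\<^esub> \<beta> x = Ide B (fobj G x)"
    by metis
  have "\<beta> (Cod A f) \<cdot>\<^bsub>B\<^esub> farr G f = farr F f \<cdot>\<^bsub>B\<^esub> \<beta> (Dom A f)" if f: "f \<in> Arr A" for f
  proof -
    define x y where "x = Dom A f" and "y = Cod A f"
    have xy: "x \<in> Obj A" "y \<in> Obj A" "Dom A f = x" "Cod A f = y"
      using f by (simp_all add: x_def y_def)
    note \<beta>' = \<beta>(1)[OF xy(1)] \<beta>(1)[OF xy(2)]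
    have nat: "\<alpha> y \<cdot>\<^bsub>B\<^esub> farr F f = farr G f \<cdot>\<^bsub>B\<^esub> \<alpha> x"
      using nt f by (simp add: nat_trans_def x_def y_def)
    \<comment> \<open>An identity is inserted in the form \<open>\<beta> y\<close> after
      \<open>\<alpha> y\<close>; naturality of \<open>\<alpha>\<close> then moves \<open>f\<close>
      past it, and \<open>\<alpha> x\<close> cancels against \<open>\<beta> x\<close>.\<close>
    have "farr F f \<cdot>\<^bsub>B\<^esub> \<beta> x = ((\<beta> y \<cdot>\<^bsub>B\<^esub> \<alpha> y) \<cdot>\<^bsub>B\<^esub> farr F f) \<cdot>\<^bsub>B\<^esub> \<beta> x"
      using \<beta> xy f by (simp add: F.target.Hom_iff)
    also have "\<dots> = \<beta> y \<cdot>\<^bsub>B\<^esub> ((\<alpha> y \<cdot>\<^bsub>B\<^esub> farr F f) \<cdot>\<^bsub>B\<^esub> \<beta> x)"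
      using \<beta>' xy f \<alpha> by (simp add: F.target.Hom_iff)
    also have "\<dots> = \<beta> y \<cdot>\<^bsub>B\<^esub> (farr G f \<cdot>\<^bsub>B\<^esub> (\<alpha> x \<cdot>\<^bsub>B\<^esub> \<beta> x))"
      unfolding nat using \<beta>' xy f \<alpha> by (simp add: F.target.Hom_iff)
    also have "\<dots> = \<beta> y \<cdot>\<^bsub>B\<^esub> farr G f"
      using \<beta> xy f by simp
    finally show ?thesis by (simp add: xy)
  qed
  then show ?thesis
    using \<beta> by (intro naturally_isomorphicI[of _ _ _ _ \<beta>])
      (auto simp: nat_trans_def F.is_functor_axioms G.is_functor_axioms)
qed

section \<open>Orthogonality\<close>

text \<open>Unique factorization is encoded as bijectivity of precomposition, so that transposing it
  along an adjunction amounts to comparing two sides of a commutative square of hom-sets.\<close>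

definition orthogonal :: "('o, 'a) category \<Rightarrow> 'a \<Rightarrow> 'o \<Rightarrow> bool" where
  "orthogonal A f z \<longleftrightarrow>
     bij_betw (\<lambda>h. h \<cdot>\<^bsub>A\<^esub> f) (Hom A (Cod A f) z) (Hom A (Dom A f) z)"

text \<open>The dual notion: arrows out of \<open>z\<close> lift uniquely through \<open>f\<close>.
  It serves for right adjoints and coreflections.\<close>

lemma orthogonal_opposite:
  "orthogonal (opposite A) f z \<longleftrightarrow>
     bij_betw (\<lambda>h. f \<cdot>\<^bsub>A\<^esub> h) (Hom A z (Dom A f)) (Hom A z (Cod A f))"
  by (simp add: orthogonal_def)

text \<open>Both conditions say that the common diagonal of the square is bijective. All transports
  of orthogonality along isomorphisms, adjunctions and currying go through this lemma.\<close>

lemma bij_betw_square: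
  assumes \<phi>: "bij_betw \<phi> S S'" and \<psi>: "bij_betw \<psi> T T'"
    and u: "\<And>s. s \<in> S \<Longrightarrow> u s \<in> T" and v: "\<And>s. s \<in> S' \<Longrightarrow> v s \<in> T'"
    and comm: "\<And>s. s \<in> S \<Longrightarrow> \<psi> (u s) = v (\<phi> s)"
  shows "bij_betw u S T \<longleftrightarrow> bij_betw v S' T'"
proof -
  have "bij_betw v S' T' \<longleftrightarrow> bij_betw (v \<circ> \<phi>) S T'"
    using bij_betw_comp_iff[OF \<phi>] by blast
  also have "\<dots> \<longleftrightarrow> bij_betw (\<psi> \<circ> u) S T'"
    by (rule bij_betw_cong) (simp add: comm)
  also have "\<dots> \<longleftrightarrow> bij_betw u S T"
    using bij_betw_comp_iff2[OF \<psi>, of u S] u by blast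
  finally show ?thesis by blast
qed

context category
begin

lemma bij_betw_precomp_iso:
  assumes "is_iso A f" "f \<in> Hom A x y"
  shows "bij_betw (\<lambda>h. h \<cdot>\<^bsub>A\<^esub> f) (Hom A y z) (Hom A x z)"
proof -
  obtain g where g: "g \<in> Hom A y x" "g \<cdot>\<^bsub>A\<^esub> f = Ide A x" "f \<cdot>\<^bsub>A\<^esub> g = Ide A y"
    using assms by (rule iso_inverse)
  show ?thesis
    by (rule bij_betw_byWitness[where f' = "\<lambda>h. h \<cdot>\<^bsub>A\<^esub> g"]) (use assms(2) g in \<open>auto simp: Hom_iff\<close>)
qed

lemma bij_betw_postcomp_iso:
  assumes "is_iso A f" "f \<in> Hom A x y"
  shows "bij_betw (\<lambda>h. f \<cdot>\<^bsub>A\<^esub> h) (Hom A z x) (Hom A z y)"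
  using category.bij_betw_precomp_iso[OF category_opposite, of f y x z] assms by simp

text \<open>This is the Yoneda lemma in the form used here: invertibility is tested on
  hom-sets.\<close>

lemma iso_iff_orthogonal:
  assumes f: "f \<in> Arr A"
  shows "is_iso A f \<longleftrightarrow> (\<forall>z \<in> Obj A. orthogonal A f z)"
proof
  assume "is_iso A f"
  with f show "\<forall>z \<in> Obj A. orthogonal A f z"
    by (auto simp: orthogonal_def Hom_iff intro!: bij_betw_precomp_iso)
next
  assume orth: "\<forall>z \<in> Obj A. orthogonal A f z"
  let ?x = "Dom A f" and ?y = "Cod A f"
  \<comment> \<open>Orthogonality to the domain extends its identity along \<open>f\<close>, which
    yields a left inverse \<open>g\<close>.\<close>
  have "Ide A ?x \<in> (\<lambda>h. h \<cdot>\<^bsub>A\<^esub> f) ` Hom A ?y ?x"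
    using orth f by (simp add: orthogonal_def bij_betw_def Hom_iff)
  then obtain g where g: "g \<in> Hom A ?y ?x" "g \<cdot>\<^bsub>A\<^esub> f = Ide A ?x" by auto
  \<comment> \<open>Orthogonality to the codomain makes \<open>g\<close> a right inverse too:
    \<open>f\<close> after \<open>g\<close> and the identity agree when precomposed with
    \<open>f\<close>.\<close>
  have "inj_on (\<lambda>h. h \<cdot>\<^bsub>A\<^esub> f) (Hom A ?y ?y)"
    using orth f by (simp add: orthogonal_def bij_betw_def)
  moreover have "(f \<cdot>\<^bsub>A\<^esub> g) \<cdot>\<^bsub>A\<^esub> f = Ide A ?y \<cdot>\<^bsub>A\<^esub> f"
    using f g by (simp add: Hom_iff)
  ultimately have "f \<cdot>\<^bsub>A\<^esub> g = Ide A ?y"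
    by (rule inj_onD) (use f g in \<open>simp_all add: Hom_iff\<close>)
  with f g show "is_iso A f" by (intro isoI[of f ?x ?y g]) (simp_all add: Hom_iff)
qed

lemma iso_iff_orthogonal_opposite:
  "f \<in> Arr A \<Longrightarrow> is_iso A f \<longleftrightarrow> (\<forall>z \<in> Obj A. orthogonal (opposite A) f z)"
  using category.iso_iff_orthogonal[OF category_opposite, of f] by simp

lemma orthogonal_iso_object:
  assumes f: "f \<in> Arr A" and s: "is_iso A s" "s \<in> Hom A z z'"
  shows "orthogonal A f z \<longleftrightarrow> orthogonal A f z'"
  unfolding orthogonal_def
  by (rule bij_betw_square[OF bij_betw_postcomp_iso[OF s] bij_betw_postcomp_iso[OF s]])
    (use f s(2) in \<open>auto simp: Hom_iff\<close>)

lemma orthogonal_iso_arrow: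
  assumes f: "f \<in> Arr A" and g: "g \<in> Arr A"
    and s: "is_iso A s" "s \<in> Hom A (Dom A f) (Dom A g)"
    and t: "is_iso A t" "t \<in> Hom A (Cod A f) (Cod A g)"
    and comm: "t \<cdot>\<^bsub>A\<^esub> f = g \<cdot>\<^bsub>A\<^esub> s"
  shows "orthogonal A g z \<longleftrightarrow> orthogonal A f z"
  unfolding orthogonal_def
  by (rule bij_betw_square[OF bij_betw_precomp_iso[OF t] bij_betw_precomp_iso[OF s]])
    (use f g s(2) t(2) comm in \<open>auto simp: Hom_iff\<close>)

end

section \<open>Adjunctions and reflections\<close>

lemma adjunction_opposite:
  assumes "adjunction A B F G \<eta> \<epsilon>"
  shows "adjunction (opposite B) (opposite A) G F \<epsilon> \<eta>"
  using assms unfolding adjunction_def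
  by (auto intro: is_functor.is_functor_opposite dest: nat_trans_opposite)

lemma fully_faithful_opposite:
  "fully_faithful A B F \<Longrightarrow> fully_faithful (opposite A) (opposite B) F"
  unfolding fully_faithful_def by (auto intro: is_functor.is_functor_opposite)

locale adjoint_pair =
  left: is_functor A B F + right: is_functor B A G
  for A :: "('o1, 'a1) category" and B :: "('o2, 'a2) category"
    and F :: "('o1, 'a1, 'o2, 'a2) cfunctor" and G :: "('o2, 'a2, 'o1, 'a1) cfunctor" +
  fixes \<eta> :: "'o1 \<Rightarrow> 'a1" and \<epsilon> :: "'o2 \<Rightarrow> 'a2"
  assumes adjunction: "adjunction A B F G \<eta> \<epsilon>"

lemma adjoint_pairI: "adjunction A B F G \<eta> \<epsilon> \<Longrightarrow> adjoint_pair A B F G \<eta> \<epsilon>"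
  by (intro adjoint_pair.intro adjoint_pair_axioms.intro) (auto simp: adjunction_def)

context adjoint_pair
begin

lemma unit_arrow [simp]:
  assumes "x \<in> Obj A"
  shows "\<eta> x \<in> Arr A" "Dom A (\<eta> x) = x" "Cod A (\<eta> x) = fobj G (fobj F x)"
  using adjunction assms by (auto simp: adjunction_def nat_trans_def Hom_def)

lemma counit_arrow [simp]:
  assumes "y \<in> Obj B"
  shows "\<epsilon> y \<in> Arr B" "Dom B (\<epsilon> y) = fobj F (fobj G y)" "Cod B (\<epsilon> y) = y"
  using adjunction assms by (auto simp: adjunction_def nat_trans_def Hom_def)

lemma unit_natural:
  "f \<in> Arr A \<Longrightarrow> \<eta> (Cod A f) \<cdot>\<^bsub>A\<^esub> f = farr G (farr F f) \<cdot>\<^bsub>A\<^esub> \<eta> (Dom A f)"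
  using adjunction by (simp add: adjunction_def nat_trans_def)

lemma counit_natural:
  "g \<in> Arr B \<Longrightarrow> \<epsilon> (Cod B g) \<cdot>\<^bsub>B\<^esub> farr F (farr G g) = g \<cdot>\<^bsub>B\<^esub> \<epsilon> (Dom B g)"
  using adjunction by (simp add: adjunction_def nat_trans_def)

lemma triangle_left: "x \<in> Obj A \<Longrightarrow> \<epsilon> (fobj F x) \<cdot>\<^bsub>B\<^esub> farr F (\<eta> x) = Ide B (fobj F x)"
  and triangle_right: "y \<in> Obj B \<Longrightarrow> farr G (\<epsilon> y) \<cdot>\<^bsub>A\<^esub> \<eta> (fobj G y) = Ide A (fobj G y)"
  using adjunction by (simp_all add: adjunction_def)

text \<open>The inverse applies \<open>F\<close> and then the counit. Each round trip reduces to one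
  naturality square followed by one triangle identity.\<close>

lemma bij_betw_transpose:
  assumes x: "x \<in> Obj A" and y: "y \<in> Obj B"
  shows "bij_betw (\<lambda>h. farr G h \<cdot>\<^bsub>A\<^esub> \<eta> x) (Hom B (fobj F x) y) (Hom A x (fobj G y))"
proof (rule bij_betw_byWitness[where f' = "\<lambda>k. \<epsilon> y \<cdot>\<^bsub>B\<^esub> farr F k"])
  show "\<forall>h \<in> Hom B (fobj F x) y. \<epsilon> y \<cdot>\<^bsub>B\<^esub> farr F (farr G h \<cdot>\<^bsub>A\<^esub> \<eta> x) = h"
  proof
    fix h assume "h \<in> Hom B (fobj F x) y"
    then have h: "h \<in> Arr B" "Dom B h = fobj F x" "Cod B h = y"
      by (simp_all add: left.target.Hom_iff)
    have "\<epsilon> y \<cdot>\<^bsub>B\<^esub> farr F (farr G h \<cdot>\<^bsub>A\<^esub> \<eta> x)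
        = (\<epsilon> y \<cdot>\<^bsub>B\<^esub> farr F (farr G h)) \<cdot>\<^bsub>B\<^esub> farr F (\<eta> x)"
      using h x y by simp
    also have "\<dots> = (h \<cdot>\<^bsub>B\<^esub> \<epsilon> (fobj F x)) \<cdot>\<^bsub>B\<^esub> farr F (\<eta> x)"
      using counit_natural[of h] h by simp
    also have "\<dots> = h"
      using triangle_left h x by simp
    finally show "\<epsilon> y \<cdot>\<^bsub>B\<^esub> farr F (farr G h \<cdot>\<^bsub>A\<^esub> \<eta> x) = h" .
  qed
  show "\<forall>k \<in> Hom A x (fobj G y). farr G (\<epsilon> y \<cdot>\<^bsub>B\<^esub> farr F k) \<cdot>\<^bsub>A\<^esub> \<eta> x = k"
  proof
    fix k assume "k \<in> Hom A x (fobj G y)"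
    then have k: "k \<in> Arr A" "Dom A k = x" "Cod A k = fobj G y"
      by (simp_all add: left.source.Hom_iff)
    have "farr G (\<epsilon> y \<cdot>\<^bsub>B\<^esub> farr F k) \<cdot>\<^bsub>A\<^esub> \<eta> x = farr G (\<epsilon> y) \<cdot>\<^bsub>A\<^esub> (farr G (farr F k) \<cdot>\<^bsub>A\<^esub> \<eta> x)"
      using k x y by simp
    also have "\<dots> = (farr G (\<epsilon> y) \<cdot>\<^bsub>A\<^esub> \<eta> (fobj G y)) \<cdot>\<^bsub>A\<^esub> k"
      using unit_natural[of k] k y by simp
    also have "\<dots> = k"
      using triangle_right k y by simp
    finally show "farr G (\<epsilon> y \<cdot>\<^bsub>B\<^esub> farr F k) \<cdot>\<^bsub>A\<^esub> \<eta> x = k" .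
  qed
qed (use x y in \<open>auto simp: left.source.Hom_iff left.target.Hom_iff\<close>)

text \<open>Transposition is natural in the source object, so it carries precomposition with
  \<open>farr F f\<close> to precomposition with \<open>f\<close>.\<close>

lemma orthogonal_left_adjoint:
  assumes f: "f \<in> Arr A" and y: "y \<in> Obj B"
  shows "orthogonal B (farr F f) y \<longleftrightarrow> orthogonal A f (fobj G y)"
proof -
  have "farr G (h \<cdot>\<^bsub>B\<^esub> farr F f) \<cdot>\<^bsub>A\<^esub> \<eta> (Dom A f) = (farr G h \<cdot>\<^bsub>A\<^esub> \<eta> (Cod A f)) \<cdot>\<^bsub>A\<^esub> f"
    if "h \<in> Hom B (fobj F (Cod A f)) y" for h
    using that f unit_natural[of f] by (simp add: left.target.Hom_iff)
  then show ?thesis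
    unfolding orthogonal_def using f y
    by (simp, intro bij_betw_square[OF bij_betw_transpose bij_betw_transpose])
      (auto simp: left.source.Hom_iff left.target.Hom_iff)
qed

lemma adjoint_pair_opposite: "adjoint_pair (opposite B) (opposite A) G F \<epsilon> \<eta>"
  by (rule adjoint_pairI[OF adjunction_opposite[OF adjunction]])

lemma orthogonal_right_adjoint:
  "\<lbrakk>g \<in> Arr B; x \<in> Obj A\<rbrakk>
    \<Longrightarrow> orthogonal (opposite A) (farr G g) x \<longleftrightarrow> orthogonal (opposite B) g (fobj F x)"
  using adjoint_pair.orthogonal_left_adjoint[OF adjoint_pair_opposite] by simp

end

section \<open>Reflections with fully faithful right adjoint\<close>

locale reflection = adjoint_pair A B F G \<eta> \<epsilon>
  for A :: "('o1, 'a1) category" and B :: "('o2, 'a2) category"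
    and F :: "('o1, 'a1, 'o2, 'a2) cfunctor" and G :: "('o2, 'a2, 'o1, 'a1) cfunctor"
    and \<eta> :: "'o1 \<Rightarrow> 'a1" and \<epsilon> :: "'o2 \<Rightarrow> 'a2" +
  assumes full: "fully_faithful B A G"
begin

text \<open>Transposition factors as the action of \<open>G\<close> on arrows followed by
  precomposition with \<open>\<eta> x\<close>. The composite is bijective by adjunction and the
  first factor by full faithfulness, hence so is the second.\<close>

lemma unit_orthogonal:
  assumes x: "x \<in> Obj A" and y: "y \<in> Obj B"
  shows "orthogonal A (\<eta> x) (fobj G y)"
proof -
  have G: "bij_betw (farr G) (Hom B (fobj F x) y) (Hom A (fobj G (fobj F x)) (fobj G y))"
    using full x y by (simp add: fully_faithful_def)
  \<comment> \<open>The factorization is a degenerate square, with an identity as its second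
    bijection.\<close>
  have id: "bij_betw (\<lambda>h. h) S S" for S :: "'a1 set" by (simp add: bij_betw_def)
  show ?thesis
    unfolding orthogonal_def using x y
      bij_betw_square[OF G id, of "\<lambda>h. farr G h \<cdot>\<^bsub>A\<^esub> \<eta> x" "Hom A x (fobj G y)" "\<lambda>h. h \<cdot>\<^bsub>A\<^esub> \<eta> x"]
      bij_betw_transpose[OF x y]
    by (auto simp: left.source.Hom_iff left.target.Hom_iff)
qed

text \<open>By Yoneda it suffices to test against each \<open>y\<close> in \<open>B\<close>, where
  the adjunction turns the test into orthogonality of \<open>\<eta> x\<close> to
  \<open>fobj G y\<close>.\<close>

lemma left_adjoint_unit_iso:
  assumes x: "x \<in> Obj A"
  shows "is_iso B (farr F (\<eta> x))"
  using x by (simp add: left.target.iso_iff_orthogonal orthogonal_left_adjoint unit_orthogonal)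

text \<open>Extending the identity of \<open>z\<close> along the unit gives a retraction
  \<open>r\<close>. The other composite is an identity because the unit is also orthogonal to the
  reflected object, which lies in the image of \<open>G\<close>.\<close>

lemma unit_iso:
  assumes z: "z \<in> Obj A" and orth: "orthogonal A (\<eta> z) z"
  shows "is_iso A (\<eta> z)"
proof -
  have "Ide A z \<in> (\<lambda>h. h \<cdot>\<^bsub>A\<^esub> \<eta> z) ` Hom A (fobj G (fobj F z)) z"
    using orth z by (simp add: orthogonal_def bij_betw_def left.source.Hom_iff)
  then obtain r where r: "r \<in> Hom A (fobj G (fobj F z)) z" "r \<cdot>\<^bsub>A\<^esub> \<eta> z = Ide A z" by auto
  have "inj_on (\<lambda>h. h \<cdot>\<^bsub>A\<^esub> \<eta> z) (Hom A (fobj G (fobj F z)) (fobj G (fobj F z)))"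
    using unit_orthogonal[of z "fobj F z"] z by (simp add: orthogonal_def bij_betw_def)
  moreover have "(\<eta> z \<cdot>\<^bsub>A\<^esub> r) \<cdot>\<^bsub>A\<^esub> \<eta> z = Ide A (fobj G (fobj F z)) \<cdot>\<^bsub>A\<^esub> \<eta> z"
    using z r by (simp add: left.source.Hom_iff)
  ultimately have "\<eta> z \<cdot>\<^bsub>A\<^esub> r = Ide A (fobj G (fobj F z))"
    by (rule inj_onD) (use z r in \<open>simp_all add: left.source.Hom_iff\<close>)
  then show ?thesis
    using z r by (intro left.source.isoI[of _ z "fobj G (fobj F z)" r]) (simp_all add: left.source.Hom_iff)
qed

text \<open>Orthogonality passes along \<open>s\<close>, so \<open>z\<close> is orthogonal to its
  own unit. With \<open>unit_iso\<close>, this identifies the essential image of \<open>G\<close>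
  with the objects whose unit is invertible.\<close>

lemma unit_iso_of_iso:
  assumes y: "y \<in> Obj B" and s: "is_iso A s" "s \<in> Hom A (fobj G y) z"
  shows "is_iso A (\<eta> z)"
proof -
  have "z \<in> Obj A" using s by (auto simp: left.source.Hom_iff)
  with left.source.orthogonal_iso_object[OF _ s, of "\<eta> z"] y show ?thesis
    by (intro unit_iso) (simp_all add: unit_orthogonal)
qed

lemma orthogonal_of_unit_iso:
  assumes x: "x \<in> Obj A" and z: "z \<in> Obj A" and "is_iso A (\<eta> z)"
  shows "orthogonal A (\<eta> x) z"
  using left.source.orthogonal_iso_object[of "\<eta> x" "\<eta> z" z "fobj G (fobj F z)"] assms
  by (simp add: unit_orthogonal left.source.Hom_iff)

end

section \<open>Cartesian closed categories\<close>

context cartesian_closed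
begin

lemma Prod_Obj [simp]: "P \<in> Obj A \<Longrightarrow> Q \<in> Obj A \<Longrightarrow> Prod K P Q \<in> Obj A"
  and Exp_Obj [simp]: "P \<in> Obj A \<Longrightarrow> Q \<in> Obj A \<Longrightarrow> Exp K P Q \<in> Obj A"
  by (simp_all add: Prod_in Exp_in)

lemma projection_arrow [simp]:
  assumes "P \<in> Obj A" "Q \<in> Obj A"
  shows "Fst K P Q \<in> Arr A" "Dom A (Fst K P Q) = Prod K P Q" "Cod A (Fst K P Q) = P"
    and "Snd K P Q \<in> Arr A" "Dom A (Snd K P Q) = Prod K P Q" "Cod A (Snd K P Q) = Q"
  using Fst_in[OF assms] Snd_in[OF assms] by (simp_all add: Hom_iff)

lemma Eval_arrow [simp]:
  assumes "P \<in> Obj A" "Q \<in> Obj A"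
  shows "Eval K P Q \<in> Arr A" "Dom A (Eval K P Q) = Prod K (Exp K P Q) P" "Cod A (Eval K P Q) = Q"
  using Eval_in[OF assms] by (simp_all add: Hom_iff)

lemma tuple_props:
  assumes "f \<in> Arr A" "g \<in> Arr A" "Dom A f = Dom A g"
  shows "tuple A K f g \<in> Hom A (Dom A f) (Prod K (Cod A f) (Cod A g)) \<and>
    Fst K (Cod A f) (Cod A g) \<cdot>\<^bsub>A\<^esub> tuple A K f g = f \<and>
    Snd K (Cod A f) (Cod A g) \<cdot>\<^bsub>A\<^esub> tuple A K f g = g"
  unfolding tuple_def
  by (rule theI', rule Prod_universal) (use assms in \<open>simp_all add: Hom_iff\<close>)

lemma tuple_arrow [simp]:
  assumes "f \<in> Arr A" "g \<in> Arr A" "Dom A f = Dom A g"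
  shows "tuple A K f g \<in> Arr A" "Dom A (tuple A K f g) = Dom A g"
    "Cod A (tuple A K f g) = Prod K (Cod A f) (Cod A g)"
  using tuple_props[OF assms] assms by (simp_all add: Hom_iff)

lemma Fst_tuple [simp]:
    "\<lbrakk>f \<in> Arr A; g \<in> Arr A; Dom A f = Dom A g; Cod A f = P; Cod A g = Q\<rbrakk>
      \<Longrightarrow> Fst K P Q \<cdot>\<^bsub>A\<^esub> tuple A K f g = f"
  and Snd_tuple [simp]:
    "\<lbrakk>f \<in> Arr A; g \<in> Arr A; Dom A f = Dom A g; Cod A f = P; Cod A g = Q\<rbrakk>
      \<Longrightarrow> Snd K P Q \<cdot>\<^bsub>A\<^esub> tuple A K f g = g"
  using tuple_props[of f g] by auto

lemma Prod_eqI: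
  assumes "h \<in> Arr A" "h' \<in> Arr A" "P \<in> Obj A" "Q \<in> Obj A" "Dom A h = Dom A h'"
    and "Cod A h = Prod K P Q" "Cod A h' = Prod K P Q"
    and "Fst K P Q \<cdot>\<^bsub>A\<^esub> h = Fst K P Q \<cdot>\<^bsub>A\<^esub> h'" "Snd K P Q \<cdot>\<^bsub>A\<^esub> h = Snd K P Q \<cdot>\<^bsub>A\<^esub> h'"
  shows "h = h'"
  by (rule ex1E[OF Prod_universal[of "Fst K P Q \<cdot>\<^bsub>A\<^esub> h" "Dom A h" P "Snd K P Q \<cdot>\<^bsub>A\<^esub> h" Q]])
    (use assms in \<open>auto simp: Hom_iff\<close>)

lemma prod_arr_eq:
  "prod_arr A K f g = tuple A K (f \<cdot>\<^bsub>A\<^esub> Fst K (Dom A f) (Dom A g)) (g \<cdot>\<^bsub>A\<^esub> Snd K (Dom A f) (Dom A g))"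
  by (simp add: prod_arr_def Prod_functor_def)

lemma prod_arr_arrow [simp]:
  assumes "f \<in> Arr A" "g \<in> Arr A"
  shows "prod_arr A K f g \<in> Arr A" "Dom A (prod_arr A K f g) = Prod K (Dom A f) (Dom A g)"
    "Cod A (prod_arr A K f g) = Prod K (Cod A f) (Cod A g)"
  using assms by (simp_all add: prod_arr_eq)

lemma Fst_prod_arr [simp]:
    "\<lbrakk>f \<in> Arr A; g \<in> Arr A; Cod A f = P; Cod A g = Q\<rbrakk>
      \<Longrightarrow> Fst K P Q \<cdot>\<^bsub>A\<^esub> prod_arr A K f g = f \<cdot>\<^bsub>A\<^esub> Fst K (Dom A f) (Dom A g)"
  and Snd_prod_arr [simp]:
    "\<lbrakk>f \<in> Arr A; g \<in> Arr A; Cod A f = P; Cod A g = Q\<rbrakk>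
      \<Longrightarrow> Snd K P Q \<cdot>\<^bsub>A\<^esub> prod_arr A K f g = g \<cdot>\<^bsub>A\<^esub> Snd K (Dom A f) (Dom A g)"
  by (simp_all add: prod_arr_eq)

text \<open>Composites are normalized to right-nested form by \<open>assoc\<close>, which hides a
  projection followed by a tuple; these versions apply to the nested form.\<close>

lemma Fst_tuple_Comp:
    "\<lbrakk>f \<in> Arr A; g \<in> Arr A; h \<in> Arr A; Dom A f = Dom A g; Cod A h = Dom A g; Cod A f = P; Cod A g = Q\<rbrakk>
      \<Longrightarrow> Fst K P Q \<cdot>\<^bsub>A\<^esub> (tuple A K f g \<cdot>\<^bsub>A\<^esub> h) = f \<cdot>\<^bsub>A\<^esub> h"
  and Snd_tuple_Comp:
    "\<lbrakk>f \<in> Arr A; g \<in> Arr A; h \<in> Arr A; Dom A f = Dom A g; Cod A h = Dom A g; Cod A f = P; Cod A g = Q\<rbrakk>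
      \<Longrightarrow> Snd K P Q \<cdot>\<^bsub>A\<^esub> (tuple A K f g \<cdot>\<^bsub>A\<^esub> h) = g \<cdot>\<^bsub>A\<^esub> h"
  by (subst assoc[symmetric]; auto)+

lemma prod_arr_tuple:
  assumes "f \<in> Arr A" "g \<in> Arr A" "a \<in> Arr A" "b \<in> Arr A"
    "Dom A a = Dom A b" "Cod A a = Dom A f" "Cod A b = Dom A g"
  shows "prod_arr A K f g \<cdot>\<^bsub>A\<^esub> tuple A K a b = tuple A K (f \<cdot>\<^bsub>A\<^esub> a) (g \<cdot>\<^bsub>A\<^esub> b)"
  by (rule Prod_eqI[where P = "Cod A f" and Q = "Cod A g"])
    (use assms in \<open>simp_all add: prod_arr_eq Fst_tuple_Comp Snd_tuple_Comp\<close>)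

lemma tuple_Comp:
  assumes "f \<in> Arr A" "g \<in> Arr A" "h \<in> Arr A" "Dom A f = Dom A g" "Cod A h = Dom A g"
  shows "tuple A K f g \<cdot>\<^bsub>A\<^esub> h = tuple A K (f \<cdot>\<^bsub>A\<^esub> h) (g \<cdot>\<^bsub>A\<^esub> h)"
  by (rule Prod_eqI[where P = "Cod A f" and Q = "Cod A g"])
    (use assms in \<open>simp_all add: Fst_tuple_Comp Snd_tuple_Comp\<close>)

lemma prod_arr_Comp:
  assumes "f \<in> Arr A" "g \<in> Arr A" "f' \<in> Arr A" "g' \<in> Arr A"
    "Cod A f = Dom A f'" "Cod A g = Dom A g'"
  shows "prod_arr A K f' g' \<cdot>\<^bsub>A\<^esub> prod_arr A K f g = prod_arr A K (f' \<cdot>\<^bsub>A\<^esub> f) (g' \<cdot>\<^bsub>A\<^esub> g)"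
  using assms by (simp add: prod_arr_eq[of f g] prod_arr_tuple, simp add: prod_arr_eq)

lemma tuple_projections:
  assumes "P \<in> Obj A" "Q \<in> Obj A"
  shows "tuple A K (Fst K P Q) (Snd K P Q) = Ide A (Prod K P Q)"
  by (rule Prod_eqI[where P = P and Q = Q]) (use assms in simp_all)

lemma prod_arr_Ide [simp]:
  "P \<in> Obj A \<Longrightarrow> Q \<in> Obj A \<Longrightarrow> prod_arr A K (Ide A P) (Ide A Q) = Ide A (Prod K P Q)"
  by (simp add: prod_arr_eq tuple_projections)

lemma Prod_functor_simps [simp]:
  "fobj (Prod_functor A K) (P, Q) = Prod K P Q"
  "farr (Prod_functor A K) (f, g) = prod_arr A K f g"
  by (simp_all add: prod_arr_def) (simp add: Prod_functor_def)

lemma is_functor_Prod: "is_functor (A \<times>\<^sub>C A) A (Prod_functor A K)"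
  by (rule is_functorI) (auto simp: category_product category_axioms Hom_iff prod_arr_Comp)

section \<open>Currying and the exponential bifunctor\<close>

lemma bij_betw_uncurry:
  assumes "R \<in> Obj A" "P \<in> Obj A" "Q \<in> Obj A"
  shows "bij_betw (\<lambda>h. Eval K P Q \<cdot>\<^bsub>A\<^esub> prod_arr A K h (Ide A P))
    (Hom A R (Exp K P Q)) (Hom A (Prod K R P) Q)"
  unfolding bij_betw_def inj_on_def
proof (intro conjI ballI impI)
  let ?u = "\<lambda>h. Eval K P Q \<cdot>\<^bsub>A\<^esub> prod_arr A K h (Ide A P)"
  have u: "?u h \<in> Hom A (Prod K R P) Q" if "h \<in> Hom A R (Exp K P Q)" for h
    using that assms by (simp add: Hom_iff)
  then show "?u ` Hom A R (Exp K P Q) = Hom A (Prod K R P) Q"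
    using Exp_universal[OF assms] by (auto simp: image_iff) metis
  show "h = h'" if "h \<in> Hom A R (Exp K P Q)" "h' \<in> Hom A R (Exp K P Q)" "?u h = ?u h'" for h h'
    using that ex1E[OF Exp_universal[OF assms u[OF that(1)]]] by metis
qed

lemma curry_props:
  assumes "R \<in> Obj A" "P \<in> Obj A" "Q \<in> Obj A" "f \<in> Hom A (Prod K R P) Q"
  shows "curry A K R P Q f \<in> Hom A R (Exp K P Q) \<and>
    Eval K P Q \<cdot>\<^bsub>A\<^esub> prod_arr A K (curry A K R P Q f) (Ide A P) = f"
  unfolding curry_def by (rule theI', rule Exp_universal) (use assms in auto)

abbreviation exp_arr :: "'a \<Rightarrow> 'a \<Rightarrow> 'a" where
  "exp_arr u v \<equiv> farr (Exp_functor A K) (u, v)"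

lemma exp_arr_props:
  assumes "u \<in> Arr A" "v \<in> Arr A"
  shows "exp_arr u v \<in> Hom A (Exp K (Cod A u) (Dom A v)) (Exp K (Dom A u) (Cod A v)) \<and>
    Eval K (Dom A u) (Cod A v) \<cdot>\<^bsub>A\<^esub> prod_arr A K (exp_arr u v) (Ide A (Dom A u)) =
      v \<cdot>\<^bsub>A\<^esub> (Eval K (Cod A u) (Dom A v) \<cdot>\<^bsub>A\<^esub> prod_arr A K (Ide A (Exp K (Cod A u) (Dom A v))) u)"
  using assms curry_props[of "Exp K (Cod A u) (Dom A v)" "Dom A u" "Cod A v"
    "v \<cdot>\<^bsub>A\<^esub> (Eval K (Cod A u) (Dom A v) \<cdot>\<^bsub>A\<^esub> prod_arr A K (Ide A (Exp K (Cod A u) (Dom A v))) u)"]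
  by (simp add: Exp_functor_def Let_def Hom_iff)

lemma exp_arr_arrow [simp]:
  assumes "u \<in> Arr A" "v \<in> Arr A"
  shows "exp_arr u v \<in> Arr A" "Dom A (exp_arr u v) = Exp K (Cod A u) (Dom A v)"
    "Cod A (exp_arr u v) = Exp K (Dom A u) (Cod A v)"
  using exp_arr_props[OF assms] by (simp_all add: Hom_iff)

text \<open>Uncurrying turns composition with \<open>exp_arr u v\<close> into postcomposition with
  \<open>v\<close> and precomposition with \<open>u\<close> on the second factor. Functoriality of
  the exponential and the orthogonality criteria for \<open>exp_arr\<close> both rest on
  this.\<close>

lemma uncurry_exp_arr_Comp:
  assumes uv: "u \<in> Arr A" "v \<in> Arr A"
    and h: "h \<in> Hom A R (Exp K (Cod A u) (Dom A v))"
  shows "Eval K (Dom A u) (Cod A v) \<cdot>\<^bsub>A\<^esub> prod_arr A K (exp_arr u v \<cdot>\<^bsub>A\<^esub> h) (Ide A (Dom A u)) =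
    v \<cdot>\<^bsub>A\<^esub> ((Eval K (Cod A u) (Dom A v) \<cdot>\<^bsub>A\<^esub> prod_arr A K h (Ide A (Cod A u))) \<cdot>\<^bsub>A\<^esub>
      prod_arr A K (Ide A R) u)"
proof -
  let ?E = "Exp K (Cod A u) (Dom A v)" and ?ev = "Eval K (Cod A u) (Dom A v)"
  have h': "h \<in> Arr A" "Dom A h = R" "Cod A h = ?E" "R \<in> Obj A"
    using h by (auto simp: Hom_iff)
  have "Eval K (Dom A u) (Cod A v) \<cdot>\<^bsub>A\<^esub> prod_arr A K (exp_arr u v \<cdot>\<^bsub>A\<^esub> h) (Ide A (Dom A u))
      = (Eval K (Dom A u) (Cod A v) \<cdot>\<^bsub>A\<^esub> prod_arr A K (exp_arr u v) (Ide A (Dom A u))) \<cdot>\<^bsub>A\<^esub>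
          prod_arr A K h (Ide A (Dom A u))"
    using uv h' by (simp add: prod_arr_Comp)
  also have "\<dots> = (v \<cdot>\<^bsub>A\<^esub> (?ev \<cdot>\<^bsub>A\<^esub> prod_arr A K (Ide A ?E) u)) \<cdot>\<^bsub>A\<^esub> prod_arr A K h (Ide A (Dom A u))"
    using exp_arr_props[OF uv] by simp
  also have "\<dots> = v \<cdot>\<^bsub>A\<^esub> (?ev \<cdot>\<^bsub>A\<^esub> prod_arr A K h u)"
    using uv h' by (simp add: prod_arr_Comp)
  also have "\<dots> = v \<cdot>\<^bsub>A\<^esub> ((?ev \<cdot>\<^bsub>A\<^esub> prod_arr A K h (Ide A (Cod A u))) \<cdot>\<^bsub>A\<^esub> prod_arr A K (Ide A R) u)"
    using uv h' by (simp add: prod_arr_Comp)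
  finally show ?thesis .
qed

lemma Exp_eqI:
  assumes "h \<in> Hom A R (Exp K P Q)" "h' \<in> Hom A R (Exp K P Q)" "P \<in> Obj A" "Q \<in> Obj A"
    and "Eval K P Q \<cdot>\<^bsub>A\<^esub> prod_arr A K h (Ide A P) = Eval K P Q \<cdot>\<^bsub>A\<^esub> prod_arr A K h' (Ide A P)"
  shows "h = h'"
proof -
  have "R \<in> Obj A" using assms(1) by (auto simp: Hom_iff)
  from bij_betw_uncurry[OF this assms(3,4)] show ?thesis
    using assms by (auto simp: bij_betw_def dest: inj_onD)
qed

lemma exp_arr_Ide:
  assumes "P \<in> Obj A" "Q \<in> Obj A"
  shows "exp_arr (Ide A P) (Ide A Q) = Ide A (Exp K P Q)"
  by (rule Exp_eqI[where R = "Exp K P Q" and P = P and Q = Q])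
    (use assms exp_arr_props[of "Ide A P" "Ide A Q"] in \<open>simp_all add: Hom_iff\<close>)

lemma exp_arr_Comp:
  assumes "u \<in> Arr A" "v \<in> Arr A" "u' \<in> Arr A" "v' \<in> Arr A"
    "Cod A u' = Dom A u" "Cod A v = Dom A v'"
  shows "exp_arr (u \<cdot>\<^bsub>A\<^esub> u') (v' \<cdot>\<^bsub>A\<^esub> v) = exp_arr u' v' \<cdot>\<^bsub>A\<^esub> exp_arr u v"
  by (rule Exp_eqI[where R = "Exp K (Cod A u) (Dom A v)" and P = "Dom A u'" and Q = "Cod A v'"])
    (use assms exp_arr_props[of u v] exp_arr_props[of "u \<cdot>\<^bsub>A\<^esub> u'" "v' \<cdot>\<^bsub>A\<^esub> v"]
      uncurry_exp_arr_Comp[of u' v' "exp_arr u v" "Exp K (Cod A u) (Dom A v)"]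
      in \<open>simp_all add: Hom_iff prod_arr_Comp\<close>)

lemma fobj_Exp_functor [simp]: "fobj (Exp_functor A K) (P, Q) = Exp K P Q"
  by (simp add: Exp_functor_def)

lemma is_functor_Exp: "is_functor (opposite A \<times>\<^sub>C A) A (Exp_functor A K)"
  by (rule is_functorI)
    (auto simp: category_product category_opposite category_axioms Hom_iff exp_arr_Comp exp_arr_Ide)

section \<open>Orthogonality in a cartesian closed category\<close>

text \<open>Currying is natural in the first factor, so this is the transposition argument for the
  adjunction between the product with \<open>Q\<close> and the exponential by
  \<open>Q\<close>.\<close>

lemma orthogonal_exponential:
  assumes f: "f \<in> Arr A" and Q: "Q \<in> Obj A" and z: "z \<in> Obj A"
  shows "orthogonal A f (Exp K Q z) \<longleftrightarrow> orthogonal A (prod_arr A K f (Ide A Q)) z"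
proof -
  have "Eval K Q z \<cdot>\<^bsub>A\<^esub> prod_arr A K (h \<cdot>\<^bsub>A\<^esub> f) (Ide A Q)
      = (Eval K Q z \<cdot>\<^bsub>A\<^esub> prod_arr A K h (Ide A Q)) \<cdot>\<^bsub>A\<^esub> prod_arr A K f (Ide A Q)"
    if "h \<in> Hom A (Cod A f) (Exp K Q z)" for h
    using that f Q z by (simp add: Hom_iff prod_arr_Comp)
  then show ?thesis
    unfolding orthogonal_def using f Q z
    by (simp, intro bij_betw_square[OF bij_betw_uncurry bij_betw_uncurry]) (auto simp: Hom_iff)
qed

text \<open>Uncurrying both hom-sets treats the two variables of the exponential together; the next
  two lemmas specialize one of them to an identity.\<close>

lemma orthogonal_exp_arr:
  assumes uv: "u \<in> Arr A" "v \<in> Arr A" and x: "x \<in> Obj A"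
  shows "orthogonal (opposite A) (exp_arr u v) x \<longleftrightarrow>
    bij_betw (\<lambda>h. v \<cdot>\<^bsub>A\<^esub> (h \<cdot>\<^bsub>A\<^esub> prod_arr A K (Ide A x) u))
      (Hom A (Prod K x (Cod A u)) (Dom A v)) (Hom A (Prod K x (Dom A u)) (Cod A v))"
  unfolding orthogonal_opposite using uv x
  by (simp, intro bij_betw_square[OF bij_betw_uncurry bij_betw_uncurry])
    (auto simp: Hom_iff uncurry_exp_arr_Comp)

lemma orthogonal_exp_arr_left:
  assumes "u \<in> Arr A" "x \<in> Obj A" "z \<in> Obj A"
  shows "orthogonal (opposite A) (exp_arr u (Ide A z)) x
    \<longleftrightarrow> orthogonal A (prod_arr A K (Ide A x) u) z"
  unfolding orthogonal_def[of A] using assms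
  by (simp add: orthogonal_exp_arr, intro bij_betw_cong) (simp add: Hom_iff)

lemma orthogonal_exp_arr_right:
  assumes "v \<in> Arr A" "x \<in> Obj A" "Q \<in> Obj A"
  shows "orthogonal (opposite A) (exp_arr (Ide A Q) v) x \<longleftrightarrow> orthogonal (opposite A) v (Prod K x Q)"
  unfolding orthogonal_opposite[of A v] using assms
  by (simp add: orthogonal_exp_arr, intro bij_betw_cong) (simp add: Hom_iff)

lemma swap_iso:
  assumes "P \<in> Obj A" "Q \<in> Obj A"
  shows "is_iso A (tuple A K (Snd K P Q) (Fst K P Q))"
  using assms
  by (intro isoI[of _ "Prod K P Q" "Prod K Q P" "tuple A K (Snd K Q P) (Fst K Q P)"])
    (simp_all add: Hom_iff tuple_Comp tuple_projections)

text \<open>Conjugation by the symmetry of the product. It reconciles the mixed Frobenius map, with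
  the unit on the left factor, with \<open>orthogonal_exp_arr_left\<close>, which puts it on the
  right.\<close>

lemma orthogonal_swap:
  assumes f: "f \<in> Arr A" and Q: "Q \<in> Obj A"
  shows "orthogonal A (prod_arr A K f (Ide A Q)) z \<longleftrightarrow> orthogonal A (prod_arr A K (Ide A Q) f) z"
proof -
  let ?s = "\<lambda>x. tuple A K (Snd K Q x) (Fst K Q x)"
  have "?s (Cod A f) \<cdot>\<^bsub>A\<^esub> prod_arr A K (Ide A Q) f = prod_arr A K f (Ide A Q) \<cdot>\<^bsub>A\<^esub> ?s (Dom A f)"
    using f Q by (simp add: tuple_Comp prod_arr_tuple)
  then show ?thesis
    using f Q by (intro orthogonal_iso_arrow[of _ _ "?s (Dom A f)" "?s (Cod A f)"])
      (simp_all add: swap_iso Hom_iff)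
qed

text \<open>Factorizations into a product are found and compared componentwise. Hence an
  orthogonality class is closed under binary products.\<close>

lemma orthogonal_Prod:
  assumes f: "f \<in> Arr A" and z: "z \<in> Obj A" "z' \<in> Obj A"
    and orth: "orthogonal A f z" "orthogonal A f z'"
  shows "orthogonal A f (Prod K z z')"
  unfolding orthogonal_def bij_betw_def
proof (intro conjI inj_onI equalityI image_subsetI subsetI)
  fix h k assume h: "h \<in> Hom A (Cod A f) (Prod K z z')" and k: "k \<in> Hom A (Cod A f) (Prod K z z')"
    and eq: "h \<cdot>\<^bsub>A\<^esub> f = k \<cdot>\<^bsub>A\<^esub> f"
  have inj: "inj_on (\<lambda>h. h \<cdot>\<^bsub>A\<^esub> f) (Hom A (Cod A f) z)" "inj_on (\<lambda>h. h \<cdot>\<^bsub>A\<^esub> f) (Hom A (Cod A f) z')"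
    using orth by (simp_all add: orthogonal_def bij_betw_def)
  show "h = k"
  proof (rule Prod_eqI[where P = z and Q = z'])
    show "Fst K z z' \<cdot>\<^bsub>A\<^esub> h = Fst K z z' \<cdot>\<^bsub>A\<^esub> k"
      by (rule inj_onD[OF inj(1)]) (use f h k z eq in \<open>simp_all add: Hom_iff\<close>)
    show "Snd K z z' \<cdot>\<^bsub>A\<^esub> h = Snd K z z' \<cdot>\<^bsub>A\<^esub> k"
      by (rule inj_onD[OF inj(2)]) (use f h k z eq in \<open>simp_all add: Hom_iff\<close>)
  qed (use h k z in \<open>simp_all add: Hom_iff\<close>)
next
  fix h assume "h \<in> Hom A (Cod A f) (Prod K z z')"
  then show "h \<cdot>\<^bsub>A\<^esub> f \<in> Hom A (Dom A f) (Prod K z z')" using f by (simp add: Hom_iff)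
next
  fix k assume k: "k \<in> Hom A (Dom A f) (Prod K z z')"
  then have "Fst K z z' \<cdot>\<^bsub>A\<^esub> k \<in> (\<lambda>h. h \<cdot>\<^bsub>A\<^esub> f) ` Hom A (Cod A f) z"
    "Snd K z z' \<cdot>\<^bsub>A\<^esub> k \<in> (\<lambda>h. h \<cdot>\<^bsub>A\<^esub> f) ` Hom A (Cod A f) z'"
    using orth z by (simp_all add: orthogonal_def bij_betw_def Hom_iff)
  then obtain a b where ab: "a \<in> Hom A (Cod A f) z" "Fst K z z' \<cdot>\<^bsub>A\<^esub> k = a \<cdot>\<^bsub>A\<^esub> f"
    "b \<in> Hom A (Cod A f) z'" "Snd K z z' \<cdot>\<^bsub>A\<^esub> k = b \<cdot>\<^bsub>A\<^esub> f" by blast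
  have "k = tuple A K a b \<cdot>\<^bsub>A\<^esub> f"
    by (rule Prod_eqI[where P = z and Q = z'])
      (use ab k z f in \<open>simp_all add: Hom_iff Fst_tuple_Comp Snd_tuple_Comp\<close>)
  moreover have "tuple A K a b \<in> Hom A (Cod A f) (Prod K z z')"
    using ab by (simp add: Hom_iff)
  ultimately show "k \<in> (\<lambda>h. h \<cdot>\<^bsub>A\<^esub> f) ` Hom A (Cod A f) (Prod K z z')" by blast
qed

end

section \<open>The laws in one fibre\<close>

lemma is_functor_exp_of:
  assumes "cartesian_closed P K" "is_functor N P j" "is_functor M P i"
  shows "is_functor (opposite N \<times>\<^sub>C M) P (Exp_functor P K \<circ>\<^sub>F (j \<times>\<^sub>F i))"
  using assms
  by (auto intro: is_functor_comp is_functor_product is_functor.is_functor_opposite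
      cartesian_closed.is_functor_Exp)

text \<open>One fibre, arranged for one member of each pair of laws: \<open>dia\<close>,
  \<open>i\<close>, \<open>box\<close> belong to one subcategory, \<open>j\<close> and
  \<open>box'\<close> to the other. The other member is obtained by exchanging the two.\<close>

locale modal_fibre = cartesian_closed P K + refl: reflection P M dia i \<eta> \<epsilon> +
  boxM: adjoint_pair M P i box \<eta>\<^sub>i \<epsilon>\<^sub>i + boxN: adjoint_pair N P j box' \<eta>\<^sub>j \<epsilon>\<^sub>j
  for P :: "('p, 'pa) category" and K :: "('p, 'pa) ccc"
    and M :: "('m, 'ma) category" and N :: "('n, 'na) category"
    and i dia box \<eta> \<epsilon> \<eta>\<^sub>i \<epsilon>\<^sub>i j box' \<eta>\<^sub>j \<epsilon>\<^sub>j
begin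

text \<open>In the opposite categories \<open>box\<close> is left adjoint to \<open>i\<close> and
  the counit \<open>\<epsilon>\<^sub>i\<close> becomes the unit, so every fact about reflections
  yields one about \<open>box\<close>.\<close>

sublocale corefl: reflection "opposite P" "opposite M" box i \<epsilon>\<^sub>i \<eta>\<^sub>i
  by (intro reflection.intro reflection_axioms.intro boxM.adjoint_pair_opposite
      fully_faithful_opposite refl.full)

text \<open>The common form of the three laws; each is shown equivalent to it separately.\<close>

definition unit_orthogonality :: bool where
  "unit_orthogonality \<longleftrightarrow> (\<forall>p \<in> Obj P. \<forall>n \<in> Obj N. \<forall>m \<in> Obj M.
     orthogonal P (prod_arr P K (\<eta> p) (Ide P (fobj j n))) (fobj i m))"

lemma unit_nat_trans: "nat_trans P P id_functor (i \<circ>\<^sub>F dia) \<eta>"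
  and counit_nat_trans: "nat_trans P P (i \<circ>\<^sub>F box) id_functor \<epsilon>\<^sub>i"
  using refl.adjunction boxM.adjunction by (simp_all add: adjunction_def)

lemma mixed_frobenius_iff: "mixed_frobenius_at P K M N i j dia \<eta> \<longleftrightarrow> unit_orthogonality"
proof -
  \<comment> \<open>The canonical map is the whiskering of \<open>\<eta>\<close> paired with
    identities, hence natural; only its invertibility is at stake.\<close>
  have "nat_trans (P \<times>\<^sub>C N) M ((dia \<circ>\<^sub>F Prod_functor P K) \<circ>\<^sub>F (id_functor \<times>\<^sub>F j))
      ((dia \<circ>\<^sub>F Prod_functor P K) \<circ>\<^sub>F ((i \<circ>\<^sub>F dia) \<times>\<^sub>F j))
      (\<lambda>x. farr (dia \<circ>\<^sub>F Prod_functor P K) (case x of (p, n) \<Rightarrow> (\<eta> p, Ide P (fobj j n))))"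
    by (rule nat_trans_whisker_left[OF nat_trans_product[OF unit_nat_trans
            nat_trans_Ide[OF boxN.left.is_functor_axioms]]
          is_functor_comp[OF is_functor_Prod refl.left.is_functor_axioms]])
  then have "nat_trans (P \<times>\<^sub>C N) M
       (dia \<circ>\<^sub>F Prod_functor P K \<circ>\<^sub>F (id_functor \<times>\<^sub>F j))
       (dia \<circ>\<^sub>F Prod_functor P K \<circ>\<^sub>F ((i \<circ>\<^sub>F dia) \<times>\<^sub>F j))
       (\<lambda>(p, n). farr dia (prod_arr P K (\<eta> p) (Ide P (fobj j n))))"
    by (simp add: comp_functor_assoc split_def)
  then have "mixed_frobenius_at P K M N i j dia \<eta> \<longleftrightarrow> (\<forall>p \<in> Obj P. \<forall>n \<in> Obj N.
      is_iso M (farr dia (prod_arr P K (\<eta> p) (Ide P (fobj j n)))))"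
    by (auto simp: mixed_frobenius_at_def nat_iso_def)
  then show ?thesis
    by (simp add: unit_orthogonality_def refl.left.target.iso_iff_orthogonal refl.orthogonal_left_adjoint)
qed

lemma law_a_iff: "law_a_at P K M N i j box \<longleftrightarrow> unit_orthogonality"
proof -
  let ?E = "\<lambda>n m. Exp K (fobj j n) (fobj i m)"
  \<comment> \<open>The factor \<open>fobj j n\<close> is moved into the exponential.\<close>
  have unit_orthogonality: "unit_orthogonality \<longleftrightarrow>
      (\<forall>p \<in> Obj P. \<forall>n \<in> Obj N. \<forall>m \<in> Obj M. orthogonal P (\<eta> p) (?E n m))"
    by (simp add: unit_orthogonality_def orthogonal_exponential)
  show ?thesis
  proof
    assume "law_a_at P K M N i j box"
    then obtain \<alpha> where "\<forall>x \<in> Obj (opposite N \<times>\<^sub>C M). is_iso P (\<alpha> x) \<and>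
        \<alpha> x \<in> Hom P (fobj (Exp_functor P K \<circ>\<^sub>F (j \<times>\<^sub>F i)) x)
          (fobj (i \<circ>\<^sub>F box \<circ>\<^sub>F Exp_functor P K \<circ>\<^sub>F (j \<times>\<^sub>F i)) x)"
      by (auto simp: law_a_at_def naturally_isomorphic_def nat_iso_def nat_trans_def
          simp del: functor_simps product_category_simps)
    then have \<alpha>: "\<alpha> (n, m) \<in> Hom P (?E n m) (fobj i (fobj box (?E n m))) \<and> is_iso P (\<alpha> (n, m))"
      if "n \<in> Obj N" "m \<in> Obj M" for n m
      using that by fastforce
    \<comment> \<open>The isomorphism \<open>\<alpha>\<close> places \<open>?E n m\<close> in the
      essential image of \<open>i\<close>, to whose objects every unit is orthogonal.\<close>
    have "orthogonal P (\<eta> p) (?E n m)" if "p \<in> Obj P" "n \<in> Obj N" "m \<in> Obj M" for p n m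
      using that \<alpha>[OF that(2,3)] refl.unit_orthogonal[of p "fobj box (?E n m)"]
        orthogonal_iso_object[of "\<eta> p" "\<alpha> (n, m)" "?E n m" "fobj i (fobj box (?E n m))"]
      by simp
    then show unit_orthogonality by (simp add: unit_orthogonality)
  next
    assume unit_orthogonality
    have "is_iso P (\<epsilon>\<^sub>i (?E n m))" if "n \<in> Obj N" "m \<in> Obj M" for n m
    proof -
      \<comment> \<open>Taking \<open>p\<close> to be \<open>?E n m\<close> itself makes its unit
        invertible. That unit is an isomorphism to an object in the image of \<open>i\<close>, so
        the coreflection counit is invertible there as well.\<close>
      have "is_iso P (\<eta> (?E n m))"
        using that \<open>unit_orthogonality\<close> by (intro refl.unit_iso) (simp_all add: unit_orthogonality)
      then show ?thesis
        using corefl.unit_iso_of_iso[of "fobj dia (?E n m)" "\<eta> (?E n m)" "?E n m"] that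
        by (simp add: Hom_iff)
    qed
    moreover have "nat_trans (opposite N \<times>\<^sub>C M) P
        ((i \<circ>\<^sub>F box) \<circ>\<^sub>F (Exp_functor P K \<circ>\<^sub>F (j \<times>\<^sub>F i)))
        (id_functor \<circ>\<^sub>F (Exp_functor P K \<circ>\<^sub>F (j \<times>\<^sub>F i)))
        (\<lambda>x. \<epsilon>\<^sub>i (fobj (Exp_functor P K \<circ>\<^sub>F (j \<times>\<^sub>F i)) x))"
      by (rule nat_trans_whisker_right[OF counit_nat_trans is_functor_exp_of[OF
              cartesian_closed_axioms boxN.left.is_functor_axioms refl.right.is_functor_axioms]])
    ultimately show "law_a_at P K M N i j box"
      unfolding law_a_at_def
      by (intro naturally_isomorphic_sym[OF naturally_isomorphicI]) (auto simp: comp_functor_assoc)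
  qed
qed

lemma law_b_iff: "law_b_at P K M N i dia box' \<longleftrightarrow> unit_orthogonality"
proof -
  let ?F = "box' \<circ>\<^sub>F Exp_functor P K"
  let ?\<beta> = "\<lambda>p m. farr ?F (\<eta> p, Ide P (fobj i m))"
  have F: "is_functor (opposite P \<times>\<^sub>C P) N ?F"
    by (intro is_functor_comp[OF is_functor_Exp] boxN.right.is_functor_axioms)
  interpret F: is_functor "opposite P \<times>\<^sub>C P" N ?F by (rule F)
  \<comment> \<open>Invertibility in \<open>N\<close> is tested on arrows out of each
    \<open>n\<close>. The adjunction of \<open>j\<close> with \<open>box'\<close> moves the test to
    \<open>fobj j n\<close>, uncurrying removes the exponential, and the swap puts the unit on the
    left.\<close>
  have "is_iso N (?\<beta> p m) \<longleftrightarrow>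
      (\<forall>n \<in> Obj N. orthogonal P (prod_arr P K (\<eta> p) (Ide P (fobj j n))) (fobj i m))"
    if "p \<in> Obj P" "m \<in> Obj M" for p m
    using that
    by (simp add: boxN.left.source.iso_iff_orthogonal_opposite boxN.orthogonal_right_adjoint
        orthogonal_exp_arr_left orthogonal_swap)
  then have unit_orthogonality: "unit_orthogonality \<longleftrightarrow> (\<forall>p \<in> Obj P. \<forall>m \<in> Obj M. is_iso N (?\<beta> p m))"
    by (auto simp: unit_orthogonality_def)
  show ?thesis
  proof
    assume "law_b_at P K M N i dia box'"
    then obtain \<alpha> where nt: "nat_trans (opposite P \<times>\<^sub>C M) N
        (?F \<circ>\<^sub>F (id_functor \<times>\<^sub>F i)) (?F \<circ>\<^sub>F ((i \<circ>\<^sub>F dia) \<times>\<^sub>F i)) \<alpha>"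
      and iso: "\<And>x. x \<in> Obj (opposite P \<times>\<^sub>C M) \<Longrightarrow> is_iso N (\<alpha> x)"
      by (auto simp: law_b_at_def naturally_isomorphic_def nat_iso_def comp_functor_assoc)
    have \<alpha>: "\<alpha> (p, m) \<in> Hom N (fobj ?F (p, fobj i m)) (fobj ?F (fobj i (fobj dia p), fobj i m))"
      if "p \<in> Obj P" "m \<in> Obj M" for p m
      using nt that by (auto simp: nat_trans_def)
    have "is_iso N (?\<beta> p m)" if p: "p \<in> Obj P" and m: "m \<in> Obj M" for p m
    proof -
      let ?T = "fobj i (fobj dia p)" and ?Tu = "farr i (farr dia (\<eta> p))"
      \<comment> \<open>Naturality of \<open>\<alpha>\<close> at the unit relates \<open>?\<beta>\<close> to its image under the reflector, which is
        invertible because the reflector inverts units.\<close>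
      have "\<forall>f \<in> Arr (opposite P \<times>\<^sub>C M).
          \<alpha> (Cod (opposite P \<times>\<^sub>C M) f) \<cdot>\<^bsub>N\<^esub> farr (?F \<circ>\<^sub>F (id_functor \<times>\<^sub>F i)) f
          = farr (?F \<circ>\<^sub>F ((i \<circ>\<^sub>F dia) \<times>\<^sub>F i)) f \<cdot>\<^bsub>N\<^esub> \<alpha> (Dom (opposite P \<times>\<^sub>C M) f)"
        using nt unfolding nat_trans_def by blast
      \<comment> \<open>In the opposite of \<open>P\<close> the unit runs from \<open>?T\<close> to
        \<open>p\<close>, so the square goes from the component at \<open>(?T, m)\<close> to the one
        at \<open>(p, m)\<close>.\<close>
      from bspec[OF this, of "(\<eta> p, Ide M m)"]
      have "\<alpha> (p, m) \<cdot>\<^bsub>N\<^esub> ?\<beta> p m = farr ?F (?Tu, Ide P (fobj i m)) \<cdot>\<^bsub>N\<^esub> \<alpha> (?T, m)"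
        using p m by simp
      moreover have "is_iso N (farr ?F (?Tu, Ide P (fobj i m)))"
        using p m by (intro F.farr_iso is_iso_product)
          (simp_all add: iso_Ide refl.right.farr_iso refl.left_adjoint_unit_iso)
      ultimately have "is_iso N (\<alpha> (p, m) \<cdot>\<^bsub>N\<^esub> ?\<beta> p m)"
        using p m iso[of "(?T, m)"] \<alpha>[of ?T m]
        by (auto intro!: boxN.left.source.iso_Comp simp: boxN.left.source.Hom_iff)
      then show ?thesis
        by (rule boxN.left.source.iso_cancel_left)
          (use p m iso[of "(p, m)"] \<alpha>[of p m] in \<open>simp_all add: boxN.left.source.Hom_iff\<close>)
    qed
    then show unit_orthogonality by (simp add: unit_orthogonality)
  next
    assume unit_orthogonality
    have "nat_trans (opposite P \<times>\<^sub>C M) N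
        (?F \<circ>\<^sub>F ((i \<circ>\<^sub>F dia) \<times>\<^sub>F i)) (?F \<circ>\<^sub>F (id_functor \<times>\<^sub>F i))
        (\<lambda>x. farr ?F (case x of (p, m) \<Rightarrow> (\<eta> p, Ide P (fobj i m))))"
      by (rule nat_trans_whisker_left[OF nat_trans_product[OF
              nat_trans_opposite[OF unit_nat_trans] nat_trans_Ide[OF refl.right.is_functor_axioms]] F])
    with \<open>unit_orthogonality\<close> show "law_b_at P K M N i dia box'"
      unfolding law_b_at_def unit_orthogonality
      by (intro naturally_isomorphic_sym[OF naturally_isomorphicI]) (auto simp: comp_functor_assoc)
  qed
qed

end

text \<open>The image of \<open>i\<close> is closed under binary products, being an orthogonality class, so a
  product \<open>i m' \<times> i m\<close> does not distinguish an object from its coreflection.\<close>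

lemma box_law:
  assumes "cartesian_closed P K" "reflection P M dia i \<eta> \<epsilon>" "adjunction M P i box \<eta>' \<epsilon>'"
  shows "box_law_at P K M i box"
proof -
  \<comment> \<open>Both roles are played by the same subcategory, with \<open>i\<close> for
    \<open>j\<close> and \<open>box\<close> for \<open>box'\<close>.\<close>
  interpret modal_fibre P K M M i dia box \<eta> \<epsilon> \<eta>' \<epsilon>' i box \<eta>' \<epsilon>'
    by (intro modal_fibre.intro assms adjoint_pairI)
  let ?F = "box \<circ>\<^sub>F Exp_functor P K"
  have F: "is_functor (opposite P \<times>\<^sub>C P) M ?F"
    by (intro is_functor_comp[OF is_functor_Exp] boxM.right.is_functor_axioms)
  have "orthogonal (opposite P) (\<epsilon>' p) (Prod K (fobj i m') (fobj i m))"
    if p: "p \<in> Obj P" and m: "m \<in> Obj M" "m' \<in> Obj M" for p m m'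
  proof -
    let ?z = "Prod K (fobj i m') (fobj i m)"
    \<comment> \<open>Both factors lie in the image of \<open>i\<close>, so the unit at
      \<open>?z\<close> is orthogonal to each of them and hence to their product.\<close>
    have "orthogonal P (\<eta> ?z) ?z"
      using m by (intro orthogonal_Prod) (simp_all add: refl.unit_orthogonal)
    then have "is_iso P (\<eta> ?z)" using m by (intro refl.unit_iso) simp_all
    then have "is_iso (opposite P) (\<epsilon>' ?z)"
      using corefl.unit_iso_of_iso[of "fobj dia ?z" "\<eta> ?z" ?z] m by (simp add: Hom_iff)
    then show ?thesis
      using corefl.orthogonal_of_unit_iso[of p ?z] p m by simp
  qed
  \<comment> \<open>Testing on arrows out of \<open>m'\<close> and transposing through
    \<open>box\<close> and the exponential leaves the lifting of arrows from the product of
    \<open>fobj i m'\<close> and \<open>fobj i m\<close> through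
    \<open>\<epsilon>' p\<close>.\<close>
  then have "is_iso M (farr ?F (Ide P (fobj i m), \<epsilon>' p))" if "p \<in> Obj P" "m \<in> Obj M" for p m
    using that
    by (simp add: refl.left.target.iso_iff_orthogonal_opposite boxM.orthogonal_right_adjoint
        orthogonal_exp_arr_right)
  moreover have "nat_trans (opposite M \<times>\<^sub>C P) M
      (?F \<circ>\<^sub>F (i \<times>\<^sub>F (i \<circ>\<^sub>F box))) (?F \<circ>\<^sub>F (i \<times>\<^sub>F id_functor))
      (\<lambda>x. farr ?F (case x of (m, p) \<Rightarrow> (Ide (opposite P) (fobj i m), \<epsilon>' p)))"
    by (rule nat_trans_whisker_left[OF nat_trans_product[OF
            nat_trans_Ide[OF refl.right.is_functor_opposite] counit_nat_trans] F])
  ultimately show ?thesis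
    unfolding box_law_at_def
    by (intro naturally_isomorphic_sym[OF naturally_isomorphicI]) (auto simp: comp_functor_assoc)
qed

section \<open>From one fibre to doctrines\<close>

lemma predoctrine_laws:
  assumes "predoctrine D" and X: "X \<in> Obj (Base D)"
  shows "mixed_frobenius_laws D X \<longleftrightarrow> laws_a D X"
    and "mixed_frobenius_laws D X \<longleftrightarrow> laws_b D X"
    and "box_laws D X"
proof -
  interpret predoctrine D by fact
  \<comment> \<open>The units of \<open>Dia\<close> and \<open>Dia'\<close> are data of the
    doctrine, since the mixed Frobenius laws mention them; the remaining units and counits are
    chosen here.\<close>
  obtain \<epsilon> \<epsilon>' \<eta>\<^sub>i \<epsilon>\<^sub>i \<eta>\<^sub>j \<epsilon>\<^sub>j where
    dia: "adjunction (CatP D X) (CatM D X) (Dia D X) (inc D X) (DiaUnit D X) \<epsilon>" and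
    dia': "adjunction (CatP D X) (CatM' D X) (Dia' D X) (inc' D X) (DiaUnit' D X) \<epsilon>'" and
    box: "adjunction (CatM D X) (CatP D X) (inc D X) (Box D X) \<eta>\<^sub>i \<epsilon>\<^sub>i" and
    box': "adjunction (CatM' D X) (CatP D X) (inc' D X) (Box' D X) \<eta>\<^sub>j \<epsilon>\<^sub>j"
    using A4_Dia[OF X] A4_Dia'[OF X] A4_Box[OF X] A4_Box'[OF X]
    by (auto simp: adjoint_with_unit_def adjoint_def)
  note refl = reflection.intro[OF adjoint_pairI[OF dia] reflection_axioms.intro[OF B1[OF X]]]
  note refl' = reflection.intro[OF adjoint_pairI[OF dia'] reflection_axioms.intro[OF B1'[OF X]]]
  interpret fst: modal_fibre "CatP D X" "Closed D X" "CatM D X" "CatM' D X" "inc D X" "Dia D X"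
    "Box D X" "DiaUnit D X" \<epsilon> \<eta>\<^sub>i \<epsilon>\<^sub>i "inc' D X" "Box' D X" \<eta>\<^sub>j \<epsilon>\<^sub>j
    by (intro modal_fibre.intro A2 X refl adjoint_pairI box box')
  \<comment> \<open>The same fibre with the two subcategories exchanged gives the second member of
    each pair.\<close>
  interpret snd: modal_fibre "CatP D X" "Closed D X" "CatM' D X" "CatM D X" "inc' D X" "Dia' D X"
    "Box' D X" "DiaUnit' D X" \<epsilon>' \<eta>\<^sub>j \<epsilon>\<^sub>j "inc D X" "Box D X" \<eta>\<^sub>i \<epsilon>\<^sub>i
    by (intro modal_fibre.intro A2 X refl' adjoint_pairI box box')
  show "mixed_frobenius_laws D X \<longleftrightarrow> laws_a D X" "mixed_frobenius_laws D X \<longleftrightarrow> laws_b D X"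
    by (simp_all add: mixed_frobenius_laws_def laws_a_def laws_b_def fst.mixed_frobenius_iff
        snd.mixed_frobenius_iff fst.law_a_iff snd.law_a_iff fst.law_b_iff snd.law_b_iff)
  show "box_laws D X"
    unfolding box_laws_def using box_law[OF A2[OF X] refl box] box_law[OF A2[OF X] refl' box'] ..
qed

theorem proposition5p2:
  fixes D :: "('c, 'f, 'm, 'ma, 'p, 'pa, 'n, 'na) doctrine"
  shows
    "(temporal_doctrine D \<longrightarrow>
        (\<forall>X \<in> Obj (Base D). laws_a D X \<and> laws_b D X)) \<and>
     (predoctrine D \<longrightarrow>
        ((\<forall>X \<in> Obj (Base D). mixed_frobenius_laws D X) \<longleftrightarrow>
         (\<forall>X \<in> Obj (Base D). laws_a D X)) \<and>
        ((\<forall>X \<in> Obj (Base D). mixed_frobenius_laws D X) \<longleftrightarrow>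
         (\<forall>X \<in> Obj (Base D). laws_b D X))) \<and>
     (temporal_doctrine D \<longrightarrow>
        (\<forall>X \<in> Obj (Base D). box_laws D X))"
proof -
  have "predoctrine D" "\<forall>X \<in> Obj (Base D). mixed_frobenius_laws D X" if "temporal_doctrine D"
    using that by (simp_all add: temporal_doctrine_def temporal_doctrine_axioms_def)
  then show ?thesis
    using predoctrine_laws[of D] by blast
qed

end
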